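(* Let $x^A=x_1^{\alpha_1}\cdots x_N^{\alpha_N}$ with $\alpha_i\ge0$, $\mathbb{R}^N_*=\{x\in\mathbb{R}^N:x_i>0\text{ whenever }\alpha_i>0\}$, $d\mu_A=\frac{x^Ae^{-|x|^2/2}}{\int_{\mathbb{R}^N_*}x^Ae^{-|x|^2/2}dx}dx$, and for $\lambda>0$, $d\mu_{A,\lambda}=\frac{x^Ae^{-|x|^2/(2\lambda^2)}}{\int_{\mathbb{R}^N_*}x^Ae^{-|x|^2/(2\lambda^2)}dx}dx$ on $\mathbb{R}^N_*$. Let $m=\int_{\mathbb{R}^N_*}x\,d\mu_A\in\mathbb{R}^N$. For $\lambda>0$ and $u\in X_{\lambda,A}$, $$\int_{\mathbb{R}^N_*}|\nabla u|^2d\mu_{A,\lambda}\ge\frac1{\lambda^2}\inf_{c\in\mathbb{R},\,\vec d\in\mathbb{R}^N}\int_{\mathbb{R}^N_*}\left(|u-c|^2+\frac12\left|u-c+\vec d\cdot m-c|m|^2-\vec d\cdot x+c\,m\cdot x\right|^2\right)d\mu_{A,\lambda}.$$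
   Context: $N_*$ is the set of $u\in C_0^\infty(\overline{\mathbb{R}^N_*})$ with $\nabla u\cdot\vec\eta=0$ on $\partial\mathbb{R}^N_*$ ($\vec\eta$ the outer normal). $X_{\lambda,A}$ is the completion of $N_*$ under the norm $\left(\int|u|^2d\mu_{A,\lambda}\right)^{1/2}+\left(\int|\nabla u|^2d\mu_{A,\lambda}\right)^{1/2}$. *)

theory Defs
  imports "HOL-Analysis.Analysis"
begin

definition Rstar :: "real^'n \<Rightarrow> (real^'n) set" where
  "Rstar \<alpha> = {x. \<forall>i. \<alpha>$i > 0 \<longrightarrow> x$i > 0}"

definition monom_A :: "real^'n \<Rightarrow> real^'n \<Rightarrow> real" where
  "monom_A \<alpha> x = (\<Prod>i\<in>UNIV. if \<alpha>$i = 0 then 1 else x$i powr \<alpha>$i)"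

definition wt :: "real^'n \<Rightarrow> real \<Rightarrow> real^'n \<Rightarrow> real" where
  "wt \<alpha> lam x = monom_A \<alpha> x * exp (- ((norm x)\<^sup>2) / (2 * lam\<^sup>2))"

definition Zconst :: "real^'n \<Rightarrow> real \<Rightarrow> real" where
  "Zconst \<alpha> lam = (LINT x|lborel. indicator (Rstar \<alpha>) x * wt \<alpha> lam x)"

definition muAl :: "real^'n \<Rightarrow> real \<Rightarrow> (real^'n) measure" where
  "muAl \<alpha> lam = density lborel
      (\<lambda>x. ennreal (indicator (Rstar \<alpha>) x * wt \<alpha> lam x / Zconst \<alpha> lam))"

definition pd :: "'n \<Rightarrow> (real^'n \<Rightarrow> real) \<Rightarrow> real^'n \<Rightarrow> real" where
  "pd i f x = frechet_derivative f (at x) (axis i 1)"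

definition grad :: "(real^'n \<Rightarrow> real) \<Rightarrow> real^'n \<Rightarrow> real^'n" where
  "grad f x = (\<chi> i. pd i f x)"

fun Ck :: "nat \<Rightarrow> (real^'n \<Rightarrow> real) set" where
  "Ck 0 = {f. continuous_on UNIV f}"
| "Ck (Suc k) = {f. (\<forall>x. f differentiable (at x)) \<and> (\<forall>i. pd i f \<in> Ck k)}"

definition Cinf :: "(real^'n \<Rightarrow> real) set" where
  "Cinf = (\<Inter>k. Ck k)"

text \<open>N_*: smooth compactly supported functions with vanishing normal derivative
  on the boundary of R^N_* (the outer normal on the face x_i = 0 is -e_i).\<close>
definition Nstar :: "real^'n \<Rightarrow> (real^'n \<Rightarrow> real) set" where
  "Nstar \<alpha> = {u. u \<in> Cinf \<and> compact (closure {x. u x \<noteq> 0}) \<and>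
      (\<forall>x\<in>closure (Rstar \<alpha>). \<forall>i. \<alpha>$i > 0 \<and> x$i = 0 \<longrightarrow> pd i u x = 0)}"

text \<open>X_{lambda,A}: the completion of N_* under the weighted H^1 norm, realised concretely
  as pairs (u, g) (function and its gradient) that are limits of sequences in N_*
  in L^2(mu_{A,lambda}) for both u and its gradient.\<close>
definition Xspace :: "real \<Rightarrow> real^'n \<Rightarrow> ((real^'n \<Rightarrow> real) \<times> (real^'n \<Rightarrow> real^'n)) set" where
  "Xspace lam \<alpha> = {(u, g). u \<in> borel_measurable (muAl \<alpha> lam) \<and> g \<in> borel_measurable (muAl \<alpha> lam) \<and>
      (\<exists>\<phi> :: nat \<Rightarrow> real^'n \<Rightarrow> real. (\<forall>n. \<phi> n \<in> Nstar \<alpha>) \<and>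
        ((\<lambda>n. \<integral>\<^sup>+ x. ennreal ((\<phi> n x - u x)^2) \<partial>muAl \<alpha> lam) \<longlonglongrightarrow> 0) \<and>
        ((\<lambda>n. \<integral>\<^sup>+ x. ennreal ((norm (grad (\<phi> n) x - g x))^2) \<partial>muAl \<alpha> lam) \<longlonglongrightarrow> 0))}"

end

(*
  Every coordinate carries either a Gaussian (alpha_i = 0) or the weight t^a exp(-t^2/(2s)) on the
  half line, s = lam^2, whose spectral gap is 2/s. The gap comes from Cauchy-Schwarz in the form
  (f x - f y)^2 <= |x^2 - y^2| * int_y^x f'(z)^2/(2z) dz, integrated over x and y: the resulting kernel
  in z is s times the density, because t^2 - s(a+1) is an eigenfunction. Splitting a function on the
  line into its even part and t times an even function reduces the Gaussian to the half line with
  exponents 0 and 2, and yields 2 Var f <= s (E f'^2 + (E f')^2). Averaging out one coordinate at a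
  time gives
    2 Var f <= s (E |grad f|^2 + sum over alpha_i = 0 of (E D_i f)^2)
  for the product measure. The right-hand side of the theorem is then estimated by c = E f and
  d = c m + d' with d'_i = E D_i f if alpha_i = 0 and d'_i = 0 otherwise; d' is orthogonal to m
  because m_i = 0 for alpha_i = 0. The inequality passes to the completion since (c, d) for an
  approximating function may be reused for u.
*)
theory Submission
  imports Defs "HOL-Probability.Probability" "HOL-Real_Asymp.Real_Asymp"
begin

section \<open>Bounded continuous functions\<close>

text \<open>The obstacle is the Gaussian, whose first eigenvalue is only 1/s, attained by linear
  functions, so a plain gap 2/s fails there. The term (E f')^2 repairs exactly this: for f(t) = t
  both sides equal 2s, while all higher Hermite modes have eigenvalue at least 2/s. On a weighted
  half line the lowest nonconstant mode is already quadratic, so only coordinates with alpha_i = 0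
  need the term. It does not pass to products by itself, because averaging yields the mean of a
  squared average instead of a squared mean; the difference is paid out of the slack in Jensen's
  inequality for the other partial derivatives. The constants fit as follows. Put V = Var f, T = E
  |grad f|^2 and S = the sum of the (E D_i f)^2. The best affine choice turns the right-hand
  integral into 3/2 V - 1/2 s S, and 2 V <= s (T + S) bounds this by 3/4 s T + 1/4 s S, at most s T
  since S <= T. Linear functions of the Gaussian coordinates give equality.\<close>

definition bcont :: "('a::topological_space \<Rightarrow> real) \<Rightarrow> bool" where
  "bcont f \<longleftrightarrow> continuous_on UNIV f \<and> bounded (range f)"

lemma bcont_iff: "bcont f \<longleftrightarrow> continuous_on UNIV f \<and> (\<exists>B. \<forall>x. \<bar>f x\<bar> \<le> B)"
  unfolding bcont_def bounded_iff by auto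

lemma bcontE:
  assumes "bcont f"
  obtains B where "continuous_on UNIV f" "\<And>x. \<bar>f x\<bar> \<le> B"
  using assms unfolding bcont_iff by blast

lemma bcont_const [simp]: "bcont (\<lambda>x. c)"
  unfolding bcont_iff by (auto intro: exI[of _ "\<bar>c\<bar>"])

lemma bcont_mult:
  assumes "bcont f" "bcont g" shows "bcont (\<lambda>x. f x * g x)"
proof -
  obtain B C where f: "continuous_on UNIV f" "\<And>x. \<bar>f x\<bar> \<le> B"
    and g: "continuous_on UNIV g" "\<And>x. \<bar>g x\<bar> \<le> C"
    using assms by (metis bcontE)
  have "\<bar>f x * g x\<bar> \<le> B * C" for x
    unfolding abs_mult using f(2)[of x] g(2)[of x] by (intro mult_mono) (linarith+)
  then show ?thesis
    unfolding bcont_iff using continuous_on_mult[OF f(1) g(1)] by auto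
qed

lemma bcont_power2:
  assumes "bcont f" shows "bcont (\<lambda>x. (f x)\<^sup>2)"
  using bcont_mult[OF assms assms] by (simp add: power2_eq_square)

lemma bcont_compose:
  assumes "bcont f" "continuous_on UNIV g" shows "bcont (\<lambda>x. f (g x))"
  using assms continuous_on_compose2[of UNIV f UNIV g] unfolding bcont_iff by auto

lemma bcont_measurable:
  assumes "bcont f" "sets M = sets borel" shows "f \<in> borel_measurable M"
  using borel_measurable_continuous_onI[of f] assms
  unfolding bcont_def by (auto cong: measurable_cong_sets)

lemma bcont_integrable:
  assumes "bcont f" "sets M = sets borel" "finite_measure M" shows "integrable M f"
proof -
  interpret finite_measure M by fact
  obtain B where "\<And>x. \<bar>f x\<bar> \<le> B" using assms(1) by (metis bcontE)
  then show ?thesis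
    using bcont_measurable[OF assms(1,2)] by (intro integrable_const_bound[of _ B]) auto
qed

lemma bcont_integrable_mult:
  assumes "bcont f" "sets M = sets borel" "integrable M p"
  shows "integrable M (\<lambda>x. p x * f x)"
proof -
  obtain B where B: "\<And>x. \<bar>f x\<bar> \<le> B" using assms(1) by (metis bcontE)
  have [measurable]: "f \<in> borel_measurable M" by (rule bcont_measurable[OF assms(1,2)])
  have [measurable]: "p \<in> borel_measurable M" using assms(3) by auto
  have "integrable M (\<lambda>x. B * \<bar>p x\<bar>)" using assms(3) by auto
  then show ?thesis
    by (rule Bochner_Integration.integrable_bound)
       (auto simp: abs_mult mult.commute intro!: AE_I2 mult_right_mono order_trans[OF B abs_ge_self])
qed

text \<open>Bounds on both functions make the integrals against the finite measures below converge,
  remove boundary terms at infinity, and give growth of order t to a function vanishing at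
  0.\<close>

definition C1b_real :: "(real \<Rightarrow> real) \<Rightarrow> (real \<Rightarrow> real) \<Rightarrow> bool" where
  "C1b_real f f' \<longleftrightarrow> bcont f \<and> bcont f' \<and> (\<forall>t. (f has_real_derivative f' t) (at t))"

lemma (in prob_space) square_integral_le:
  fixes f :: "'a \<Rightarrow> real"
  assumes "integrable M f" "integrable M (\<lambda>x. (f x)\<^sup>2)"
  shows "(integral\<^sup>L M f)\<^sup>2 \<le> (\<integral>x. (f x)\<^sup>2 \<partial>M)"
proof -
  let ?c = "integral\<^sup>L M f"
  have "0 \<le> (\<integral>x. (f x - ?c)\<^sup>2 \<partial>M)" by simp
  also have "\<dots> = (\<integral>x. (f x)\<^sup>2 + ?c\<^sup>2 - 2 * ?c * f x \<partial>M)"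
    by (simp add: power2_eq_square algebra_simps)
  also have "\<dots> = (\<integral>x. (f x)\<^sup>2 \<partial>M) - ?c\<^sup>2"
    using assms by (simp add: prob_space power2_eq_square)
  finally show ?thesis by simp
qed

section \<open>The weighted half line\<close>

definition half_weight :: "real \<Rightarrow> real \<Rightarrow> real \<Rightarrow> real" where
  "half_weight s a t = t powr a * exp (- t\<^sup>2 / (2 * s))"

definition half_mass :: "real \<Rightarrow> real \<Rightarrow> real" where
  "half_mass s a = (LINT t|lborel. indicator {0<..} t * half_weight s a t)"

definition half_measure :: "real \<Rightarrow> real \<Rightarrow> real measure" where
  "half_measure s a = density lborel (\<lambda>t. ennreal (indicator {0<..} t * half_weight s a t / half_mass s a))"

lemma half_weight_measurable [measurable]: "half_weight s a \<in> borel_measurable borel"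
  unfolding half_weight_def by measurable

lemma half_weight_nonneg [simp]: "0 \<le> half_weight s a t"
  by (simp add: half_weight_def)

lemma half_weight_mult_square: "t > 0 \<Longrightarrow> t\<^sup>2 * half_weight s a t = half_weight s (a + 2) t"
  by (simp add: half_weight_def powr_add powr_numeral)

text \<open>Completing the square gives t - s/2 <= t^2/(2s), which dominates the weight by a
  constant multiple of the Gamma integrand.\<close>

lemma half_weight_integrable:
  assumes "s > 0" "a \<ge> 0"
  shows "integrable lborel (\<lambda>t. indicator {0<..} t * half_weight s a t)"
proof -
  have G: "((\<lambda>t. t powr (a + 1 - 1) / exp t) has_integral Gamma (a + 1)) {0..}"
    using assms by (intro Gamma_integral_real) auto
  have "((\<lambda>t. t powr a / exp t) has_integral Gamma (a + 1)) {0..}"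
    using G by simp
  then have "integral\<^sup>N lborel (\<lambda>t. ennreal (indicator {0..} t * (t powr a / exp t))) = ennreal (Gamma (a + 1))"
    using assms by (intro nn_integral_has_integral_lebesgue) auto
  then have "integrable lborel (\<lambda>t. indicator {0..} t * (t powr a / exp t) :: real)"
    by (intro integrableI_nonneg) auto
  then have "integrable lborel (\<lambda>t. exp (s / 2) * (indicator {0..} t * (t powr a / exp t)) :: real)"
    by (intro integrable_mult_right)
  then show ?thesis
  proof (rule Bochner_Integration.integrable_bound)
    have "half_weight s a t \<le> exp (s / 2) * (t powr a / exp t)" for t
    proof -
      have "0 \<le> (t - s)\<^sup>2 / (2 * s)" using assms by simp
      also have "\<dots> = t\<^sup>2 / (2 * s) - t + s / 2"
        using assms by (simp add: field_simps power2_eq_square)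
      finally have "exp (- t\<^sup>2 / (2 * s)) \<le> exp (s / 2 - t)" by simp
      then show ?thesis
        unfolding half_weight_def
        using mult_left_mono[of "exp (- t\<^sup>2 / (2 * s))" "exp (s / 2 - t)" "t powr a"]
        by (simp add: exp_diff mult_ac)
    qed
    then show "AE t in lborel. norm (indicator {0<..} t * half_weight s a t)
        \<le> norm (exp (s / 2) * (indicator {0..} t * (t powr a / exp t)))"
      by (intro AE_I2) (auto simp: indicator_def)
  qed measurable
qed

lemma half_mass_pos:
  assumes "s > 0" "a \<ge> 0" shows "half_mass s a > 0"
proof -
  \<comment> \<open>A lower bound for the Gaussian factor on [1,2], where also
    \<open>t powr a\<close> is at least 1.\<close>
  let ?m = "exp (- 4 / (2 * s)) :: real"
  have "0 < ?m * measure lborel {1..2::real}" by simp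
  also have "\<dots> = (\<integral>t. ?m * indicator {1..2::real} t \<partial>lborel)" by simp
  also have "\<dots> \<le> half_mass s a"
    unfolding half_mass_def
  proof (rule integral_mono)
    fix t :: real
    show "?m * indicator {1..2::real} t \<le> indicator {0<..} t * half_weight s a t"
    proof (cases "t \<in> {1..2}")
      case True
      then have "t\<^sup>2 \<le> 2\<^sup>2" by (intro power_mono) auto
      then have "t\<^sup>2 / (2 * s) \<le> 4 / (2 * s)" using assms by (intro divide_right_mono) auto
      then have "?m \<le> exp (- t\<^sup>2 / (2 * s))" by simp
      moreover have "1 \<le> t powr a" using True assms by (simp add: ge_one_powr_ge_zero)
      ultimately have "1 * ?m \<le> t powr a * exp (- t\<^sup>2 / (2 * s))" by (intro mult_mono) auto
      with True show ?thesis by (simp add: half_weight_def)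
    qed simp
  qed (use half_weight_integrable assms in auto)
  finally show ?thesis .
qed

lemma sets_half_measure [simp, measurable_cong]: "sets (half_measure s a) = sets borel"
  by (simp add: half_measure_def)

lemma space_half_measure [simp]: "space (half_measure s a) = UNIV"
  by (simp add: half_measure_def)

lemma nn_integral_half_measure:
  assumes [measurable]: "f \<in> borel_measurable borel"
  shows "(\<integral>\<^sup>+t. f t \<partial>half_measure s a)
    = (\<integral>\<^sup>+t. ennreal (indicator {0<..} t * half_weight s a t / half_mass s a) * f t \<partial>lborel)"
  unfolding half_measure_def by (subst nn_integral_density) auto

lemma prob_space_half_measure:
  assumes "s > 0" "a \<ge> 0" shows "prob_space (half_measure s a)"
proof
  have "emeasure (half_measure s a) UNIV
      = (\<integral>\<^sup>+t. ennreal (indicator {0<..} t * half_weight s a t / half_mass s a) \<partial>lborel)"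
    unfolding half_measure_def by (subst emeasure_density) auto
  also have "\<dots> = ennreal (\<integral>t. indicator {0<..} t * half_weight s a t / half_mass s a \<partial>lborel)"
    using half_weight_integrable[OF assms] half_mass_pos[OF assms]
    by (intro nn_integral_eq_integral) auto
  also have "\<dots> = 1"
    using half_mass_pos[OF assms] by (simp add: half_mass_def)
  finally show "emeasure (half_measure s a) (space (half_measure s a)) = 1" by simp
qed

lemma AE_half_measure: "AE t in half_measure s a. t > 0"
  unfolding half_measure_def by (subst AE_density) (auto simp: indicator_def)

lemma
  fixes f :: "real \<Rightarrow> real"
  assumes "s > 0" "a \<ge> 0" and [measurable]: "f \<in> borel_measurable borel"
  shows integrable_half_measure_iff: "integrable (half_measure s a) f \<longleftrightarrow>
      integrable lborel (\<lambda>t. indicator {0<..} t * (half_weight s a t * f t))"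
    and integral_half_measure: "(\<integral>t. f t \<partial>half_measure s a) =
      (\<integral>t. indicator {0<..} t * (half_weight s a t * f t) \<partial>lborel) / half_mass s a"
proof -
  have Z: "half_mass s a > 0" by (rule half_mass_pos[OF assms(1,2)])
  have "integrable (half_measure s a) f \<longleftrightarrow>
      integrable lborel (\<lambda>t. (indicator {0<..} t * (half_weight s a t * f t)) / half_mass s a)"
    unfolding half_measure_def using Z by (subst integrable_density) (auto simp: mult.assoc)
  then show "integrable (half_measure s a) f \<longleftrightarrow>
      integrable lborel (\<lambda>t. indicator {0<..} t * (half_weight s a t * f t))"
    using Z integrable_mult_left_iff[of lborel "1 / half_mass s a"] by simp
  have "(\<integral>t. f t \<partial>half_measure s a) =
      (\<integral>t. (indicator {0<..} t * (half_weight s a t * f t)) / half_mass s a \<partial>lborel)"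
    unfolding half_measure_def using Z by (subst integral_density) (auto simp: mult.assoc)
  then show "(\<integral>t. f t \<partial>half_measure s a) =
      (\<integral>t. indicator {0<..} t * (half_weight s a t * f t) \<partial>lborel) / half_mass s a"
    by simp
qed

lemma half_measure_square_integrable:
  assumes "s > 0" "a \<ge> 0"
  shows "integrable (half_measure s a) (\<lambda>t. t\<^sup>2)"
proof -
  have "(\<lambda>t. indicator {0<..} t * (half_weight s a t * t\<^sup>2)) = (\<lambda>t. indicator {0<..} t * half_weight s (a + 2) t)"
    using half_weight_mult_square[of _ s a] by (auto simp: fun_eq_iff indicator_def mult.commute)
  then show ?thesis
    using half_weight_integrable[of s "a + 2"] assms by (subst integrable_half_measure_iff) auto
qed

text \<open>The function t^2 - s (a + 1) is, up to scaling, the first nonconstant eigenfunction of the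
  Neumann operator of the weight; this integrates its eigenvalue equation over the tail.\<close>

lemma half_measure_tail:
  assumes "s > 0" "a \<ge> 0" "z \<ge> 0"
  shows "(\<integral>t. indicator {z<..} t * (t\<^sup>2 - s * (a + 1)) \<partial>half_measure s a)
    = s * (z * half_weight s a z) / half_mass s a"
proof -
  \<comment> \<open>\<open>F\<close> is -s/2 times the weight times the derivative of t^2, so that
    F' = \<open>h\<close> is the eigenvalue equation in divergence form.\<close>
  define F where "F t = - s * (t powr (a + 1) * exp (- t\<^sup>2 / (2 * s)))" for t :: real
  define h where "h t = half_weight s a t * (t\<^sup>2 - s * (a + 1))" for t :: real
  have der: "(F has_real_derivative h t) (at t)" if "t > 0" for t
  proof -
    have "t powr (a + 1) = t * t powr a" using that by (simp add: powr_add)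
    then show ?thesis
      unfolding F_def h_def half_weight_def using that assms
      by (auto intro!: derivative_eq_intros simp: field_simps power2_eq_square)
  qed
  have cont: "isCont h t" if "t > 0" for t
    unfolding h_def half_weight_def using that assms by (intro continuous_intros) auto
  have "integrable (half_measure s a) (\<lambda>t. t\<^sup>2 - s * (a + 1))"
    using half_measure_square_integrable[OF assms(1,2)] prob_space_half_measure[OF assms(1,2)]
    by (simp add: prob_space.finite_measure finite_measure.integrable_const)
  then have int: "integrable lborel (\<lambda>t. indicator {0<..} t * h t)"
    unfolding h_def by (subst (asm) integrable_half_measure_iff[OF assms(1,2)]) auto
  have int: "set_integrable lborel {z<..} h"
    unfolding set_integrable_def real_scaleR_def
    using assms(3) by (intro Bochner_Integration.integrable_bound[OF int])
      (auto simp: h_def indicator_def)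
  have lim_top: "(F \<longlongrightarrow> 0) at_top"
    unfolding F_def using assms by real_asymp
  \<comment> \<open>The case z = 0 is separate because \<open>der\<close> covers only t > 0; it is
    the case that later yields the second moment.\<close>
  have lim_z: "(F \<longlongrightarrow> F z) (at_right z)"
  proof (cases "z = 0")
    case True
    have "(F \<longlongrightarrow> 0) (at_right 0)" unfolding F_def using assms by real_asymp
    moreover have "F 0 = 0" by (simp add: F_def)
    ultimately show ?thesis using True by simp
  next
    case False
    then show ?thesis
      using DERIV_isCont[OF der[of z]] assms(3) by (simp add: isCont_def filterlim_at_split)
  qed
  have "(LBINT t=ereal z..\<infinity>. h t) = 0 - F z"
  proof (rule interval_integral_FTC_integrable)
    show "(F has_vector_derivative h t) (at t)" if "ereal z < ereal t" for t
      using der[of t] that assms(3) by (simp add: has_real_derivative_iff_has_vector_derivative)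
    show "isCont h t" if "ereal z < ereal t" for t
      using cont[of t] that assms(3) by simp
    show "set_integrable lborel (einterval (ereal z) \<infinity>) h" using int by simp
    show "((F \<circ> real_of_ereal) \<longlongrightarrow> F z) (at_right (ereal z))"
      using lim_z by (simp add: ereal_tendsto_simps)
    show "((F \<circ> real_of_ereal) \<longlongrightarrow> 0) (at_left \<infinity>)"
      using lim_top by (simp add: ereal_tendsto_simps)
  qed simp
  then have "(\<integral>t. indicator {z<..} t * h t \<partial>lborel) = - F z"
    by (simp add: interval_lebesgue_integral_def set_lebesgue_integral_def)
  moreover have "F z = - s * (z * half_weight s a z)"
    unfolding F_def half_weight_def using assms by (cases "z = 0") (auto simp: powr_add)
  moreover have "(\<lambda>t. indicator {0<..} t * (half_weight s a t * (indicator {z<..} t * (t\<^sup>2 - s * (a + 1)))))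
      = (\<lambda>t. indicator {z<..} t * h t)"
    using assms(3) by (auto simp: fun_eq_iff h_def indicator_def)
  ultimately show ?thesis
    by (subst integral_half_measure[OF assms(1,2)]) simp_all
qed

text \<open>The tail identity at z = 0 says that the eigenfunction has mean zero.\<close>

lemma half_measure_second_moment:
  assumes "s > 0" "a \<ge> 0"
  shows "(\<integral>t. t\<^sup>2 \<partial>half_measure s a) = s * (a + 1)"
proof -
  interpret prob_space "half_measure s a" by (rule prob_space_half_measure[OF assms])
  have "(\<integral>t. indicator {0<..} t * (t\<^sup>2 - s * (a + 1)) \<partial>half_measure s a)
      = (\<integral>t. t\<^sup>2 - s * (a + 1) \<partial>half_measure s a)"
    using AE_half_measure[of s a] by (intro integral_cong_AE) (auto elim!: AE_mp)
  also have "\<dots> = (\<integral>t. t\<^sup>2 \<partial>half_measure s a) - s * (a + 1)"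
    using half_measure_square_integrable[OF assms] by (simp add: prob_space[simplified])
  finally show ?thesis using half_measure_tail[OF assms, of 0] by simp
qed

section \<open>Poincare inequality on the half line\<close>

text \<open>Cauchy-Schwarz for f' = sqrt(2z) * (f' / sqrt(2z)). The weight 2z is the derivative of
  the eigenfunction t^2 - s (a + 1), the choice that makes the resulting constant sharp.\<close>

lemma nn_integral_cauchy_schwarz_square:
  fixes f f' :: "real \<Rightarrow> real"
  assumes "0 < y" "y < x"
    and der: "\<And>t. t > 0 \<Longrightarrow> (f has_real_derivative f' t) (at t)"
    and cont: "continuous_on {0<..} f'"
  shows "ennreal ((f x - f y)\<^sup>2)
    \<le> ennreal (x\<^sup>2 - y\<^sup>2) * (\<integral>\<^sup>+z. ennreal ((f' z)\<^sup>2 / (2 * z)) * indicator {y..x} z \<partial>lborel)"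
proof -
  \<comment> \<open>The slope for which b z^2 has the same increment as f; it maximises 2 b (f x - f
    y) - b^2 (x^2 - y^2), the integral of the lower bound \<open>?g\<close> of
    \<open>?h\<close>.\<close>
  define b where "b = (f x - f y) / (x\<^sup>2 - y\<^sup>2)"
  have xy: "x\<^sup>2 - y\<^sup>2 > 0" using assms(1,2) by (simp add: power_strict_mono)
  let ?g = "\<lambda>z. 2 * b * f' z - b\<^sup>2 * (2 * z)"
  let ?h = "\<lambda>z. (f' z)\<^sup>2 / (2 * z)"
  have sub: "{y..x} \<subseteq> {0<..}" using assms(1) by auto
  have c: "continuous_on {y..x} f'" by (rule continuous_on_subset[OF cont sub])
  have ig: "set_integrable lborel {y..x} ?g"
    by (intro borel_integrable_atLeastAtMost' continuous_intros c)
  have ih: "set_integrable lborel {y..x} ?h"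
    by (intro borel_integrable_atLeastAtMost' continuous_intros c) (use assms(1) in auto)
  have le: "?g z \<le> ?h z" if "z > 0" for z
  proof -
    have "0 \<le> (f' z - 2 * b * z)\<^sup>2 / (2 * z)" using that by simp
    also have "\<dots> = ?h z - ?g z" using that by (simp add: field_simps power2_eq_square)
    finally show ?thesis by simp
  qed
  have "(LBINT z:{y..x}. ?g z) = (2 * b * f x - b\<^sup>2 * x\<^sup>2) - (2 * b * f y - b\<^sup>2 * y\<^sup>2)"
    unfolding set_lebesgue_integral_def real_scaleR_def mult.commute[of "indicator _ _"]
  proof (rule integral_FTC_Icc_real)
    show "((\<lambda>z. 2 * b * f z - b\<^sup>2 * z\<^sup>2) has_real_derivative ?g z) (at z)" if "y \<le> z" "z \<le> x" for z
      using that assms(1) by (auto intro!: derivative_eq_intros der)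
    show "isCont ?g z" if "y \<le> z" "z \<le> x" for z
      using that assms(1) cont by (intro continuous_intros) (auto simp: continuous_on_eq_continuous_at)
  qed (use assms in simp)
  also have "\<dots> = 2 * b * (f x - f y) - b * (b * (x\<^sup>2 - y\<^sup>2))"
    by (simp add: power2_eq_square algebra_simps)
  also have "\<dots> = b * (f x - f y)"
    using xy by (simp add: b_def)
  finally have "(LBINT z:{y..x}. ?g z) = b * (f x - f y)" .
  moreover have "(LBINT z:{y..x}. ?g z) \<le> (LBINT z:{y..x}. ?h z)"
    using sub by (intro set_integral_mono ig ih le) auto
  ultimately have *: "b * (f x - f y) \<le> (LBINT z:{y..x}. ?h z)" by simp
  have "(f x - f y)\<^sup>2 = (x\<^sup>2 - y\<^sup>2) * (b * (f x - f y))"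
    using xy by (simp add: b_def power2_eq_square)
  also have "\<dots> \<le> (x\<^sup>2 - y\<^sup>2) * (LBINT z:{y..x}. ?h z)"
    using xy * by (intro mult_left_mono) auto
  finally have "ennreal ((f x - f y)\<^sup>2) \<le> ennreal (x\<^sup>2 - y\<^sup>2) * ennreal (LBINT z:{y..x}. ?h z)"
    using xy by (simp add: ennreal_mult'[symmetric] ennreal_leI)
  also have "ennreal (LBINT z:{y..x}. ?h z) = (\<integral>\<^sup>+z. ennreal (indicator {y..x} z * ?h z) \<partial>lborel)"
    unfolding set_lebesgue_integral_def real_scaleR_def
    using ih[unfolded set_integrable_def real_scaleR_def] assms(1)
    by (intro nn_integral_eq_integral[symmetric]) (auto simp: indicator_def)
  also have "\<dots> = (\<integral>\<^sup>+z. ennreal (?h z) * indicator {y..x} z \<partial>lborel)"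
    by (intro nn_integral_cong) (auto simp: indicator_def)
  finally show ?thesis .
qed

text \<open>For y <= z < x the factor x^2 - y^2 splits at z into two terms in one variable each, and
  the left-hand side is its double integral over that region; \<open>ennreal\<close> takes positive
  parts. The z^2 terms cancel, and what remains is the tail integral given by
  \<open>half_measure_tail\<close>.\<close>

lemma half_measure_kernel:
  assumes "s > 0" "a \<ge> 0" "z > 0"
  defines "N \<equiv> half_measure s a"
  shows "(\<integral>\<^sup>+x. ennreal (x\<^sup>2 - z\<^sup>2) \<partial>N) * emeasure N {..z} + (\<integral>\<^sup>+y. ennreal (z\<^sup>2 - y\<^sup>2) \<partial>N) * emeasure N {z<..}
    = ennreal (s * (z * half_weight s a z) / half_mass s a)"
proof -
  interpret prob_space N unfolding N_def by (rule prob_space_half_measure[OF assms(1,2)])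
  have [measurable_cong, simp]: "sets N = sets borel" and [simp]: "space N = UNIV" by (simp_all add: N_def)
  have pos: "AE t in N. t > 0" unfolding N_def by (rule AE_half_measure)
  have sq: "integrable N (\<lambda>t. t\<^sup>2)" unfolding N_def by (rule half_measure_square_integrable[OF assms(1,2)])
  define c where "c = s * (a + 1)"
  define p where "p = measure N {z<..}"
  define q where "q = measure N {..z}"
  have pq: "p + q = 1"
  proof -
    have "measure N ({z<..} \<union> {..z}) = p + q" unfolding p_def q_def by (rule finite_measure_Union) auto
    moreover have "{z<..} \<union> {..z} = UNIV" by auto
    ultimately show ?thesis using prob_space by simp
  qed
  define I where "I = (\<integral>t. indicator {z<..} t * t\<^sup>2 \<partial>N)"
  define L where "L = (\<integral>t. indicator {..z} t * t\<^sup>2 \<partial>N)"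
  have i1: "integrable N (\<lambda>t. indicator {z<..} t * t\<^sup>2)" "integrable N (\<lambda>t. indicator {..z} t * t\<^sup>2)"
    using integrable_real_mult_indicator[OF _ sq] by (auto simp: mult.commute)
  have i2: "integrable N (indicator {z<..} :: real \<Rightarrow> real)" "integrable N (indicator {..z} :: real \<Rightarrow> real)"
    by (rule integrable_const_bound[of _ 1]; simp)+
  have "I + L = (\<integral>t. indicator {z<..} t * t\<^sup>2 + indicator {..z} t * t\<^sup>2 \<partial>N)"
    unfolding I_def L_def using i1 by simp
  also have "\<dots> = (\<integral>t. t\<^sup>2 \<partial>N)"
    by (intro Bochner_Integration.integral_cong) (auto simp: indicator_def)
  finally have IL: "I + L = c" unfolding c_def N_def by (simp add: half_measure_second_moment assms)
  have "s * (z * half_weight s a z) / half_mass s a = (\<integral>t. indicator {z<..} t * (t\<^sup>2 - c) \<partial>N)"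
    unfolding N_def c_def using half_measure_tail[OF assms(1,2), of z] assms(3) by simp
  also have "\<dots> = I - c * p"
    unfolding I_def p_def using i1 i2 by (simp add: right_diff_distrib mult.commute[of _ c])
  finally have A: "s * (z * half_weight s a z) / half_mass s a = I - c * p" .
  have "(\<integral>\<^sup>+x. ennreal (x\<^sup>2 - z\<^sup>2) \<partial>N) = (\<integral>\<^sup>+x. ennreal (indicator {z<..} x * x\<^sup>2 - z\<^sup>2 * indicator {z<..} x) \<partial>N)"
  proof (rule nn_integral_cong_AE, use pos in eventually_elim)
    fix t :: real assume "t > 0"
    then have "t\<^sup>2 \<le> z\<^sup>2" if "t \<le> z" using that by (intro power_mono) auto
    then show "ennreal (t\<^sup>2 - z\<^sup>2) = ennreal (indicator {z<..} t * t\<^sup>2 - z\<^sup>2 * indicator {z<..} t)"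
      by (auto simp: indicator_def ennreal_neg)
  qed
  also have "\<dots> = ennreal (\<integral>x. indicator {z<..} x * x\<^sup>2 - z\<^sup>2 * indicator {z<..} x \<partial>N)"
  proof (rule nn_integral_eq_integral)
    show "AE x in N. 0 \<le> indicator {z<..} x * x\<^sup>2 - z\<^sup>2 * indicator {z<..} x"
      using assms(3) by (auto simp: indicator_def intro!: power_mono)
  qed (use i1 i2 in auto)
  also have "\<dots> = ennreal (I - z\<^sup>2 * p)"
    unfolding I_def p_def using i1 i2 by simp
  finally have P: "(\<integral>\<^sup>+x. ennreal (x\<^sup>2 - z\<^sup>2) \<partial>N) = ennreal (I - z\<^sup>2 * p)" .
  have Pn: "0 \<le> I - z\<^sup>2 * p"
  proof -
    have "0 \<le> (\<integral>x. indicator {z<..} x * x\<^sup>2 - z\<^sup>2 * indicator {z<..} x \<partial>N)"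
      using assms(3) by (intro Bochner_Integration.integral_nonneg) (auto simp: indicator_def intro!: power_mono)
    then show ?thesis unfolding I_def p_def using i1 i2 by simp
  qed
  have "(\<integral>\<^sup>+y. ennreal (z\<^sup>2 - y\<^sup>2) \<partial>N) = (\<integral>\<^sup>+y. ennreal (z\<^sup>2 * indicator {..z} y - indicator {..z} y * y\<^sup>2) \<partial>N)"
  proof (rule nn_integral_cong_AE, use pos in eventually_elim)
    fix t :: real assume "t > 0"
    have "z\<^sup>2 \<le> t\<^sup>2" if "z < t" using that assms(3) by (intro power_mono) auto
    then show "ennreal (z\<^sup>2 - t\<^sup>2) = ennreal (z\<^sup>2 * indicator {..z} t - indicator {..z} t * t\<^sup>2)"
      by (auto simp: indicator_def ennreal_neg)
  qed
  also have "\<dots> = ennreal (\<integral>y. z\<^sup>2 * indicator {..z} y - indicator {..z} y * y\<^sup>2 \<partial>N)"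
  proof (intro nn_integral_eq_integral)
    show "AE y in N. 0 \<le> z\<^sup>2 * indicator {..z} y - indicator {..z} y * y\<^sup>2"
      using pos by eventually_elim (auto simp: indicator_def intro!: power_mono)
  qed (use i1 i2 in auto)
  also have "\<dots> = ennreal (z\<^sup>2 * q - L)"
    unfolding L_def q_def using i1 i2 by simp
  finally have Q: "(\<integral>\<^sup>+y. ennreal (z\<^sup>2 - y\<^sup>2) \<partial>N) = ennreal (z\<^sup>2 * q - L)" .
  have Qn: "0 \<le> z\<^sup>2 * q - L"
  proof -
    have "0 \<le> (\<integral>y. z\<^sup>2 * indicator {..z} y - indicator {..z} y * y\<^sup>2 \<partial>N)"
      using pos by (intro integral_nonneg_AE) (auto simp: indicator_def intro!: power_mono elim!: AE_mp)
    then show ?thesis unfolding L_def q_def using i1 i2 by simp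
  qed
  \<comment> \<open>The terms z^2 p q cancel; then p + q = 1 and I + L = c turn I q - L p into I - c
    p.\<close>
  have "(I - z\<^sup>2 * p) * q + (z\<^sup>2 * q - L) * p = I - c * p"
  proof -
    have q: "q = 1 - p" and L: "L = c - I" using pq IL by auto
    show ?thesis unfolding q L by (simp add: algebra_simps)
  qed
  moreover have "ennreal x * ennreal q + ennreal y * ennreal p = ennreal (x * q + y * p)"
    if "0 \<le> x" "0 \<le> y" for x y
    using that by (simp add: ennreal_mult p_def q_def)
  ultimately show ?thesis
    unfolding P Q A emeasure_eq_measure p_def[symmetric] q_def[symmetric] using Pn Qn by simp
qed

text \<open>The double integral is twice the variance. After inserting the pointwise Cauchy-Schwarz
  bound and exchanging integrals, the factor z of the kernel cancels the weight 1/z, leaving s f'^2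
  against the density itself. Nonnegative integrals make every exchange of order free of
  integrability conditions.\<close>

lemma half_measure_poincare_nn:
  fixes f f' :: "real \<Rightarrow> real"
  assumes s: "s > 0" and a: "a \<ge> 0"
    and der: "\<And>t. t > 0 \<Longrightarrow> (f has_real_derivative f' t) (at t)"
    and cont: "continuous_on {0<..} f'" and meas [measurable]: "f' \<in> borel_measurable borel"
  defines "N \<equiv> half_measure s a"
  shows "(\<integral>\<^sup>+y. \<integral>\<^sup>+x. ennreal ((f x - f y)\<^sup>2) \<partial>N \<partial>N) \<le> ennreal s * (\<integral>\<^sup>+z. ennreal ((f' z)\<^sup>2) \<partial>N)"
proof -
  interpret prob_space N unfolding N_def by (rule prob_space_half_measure[OF s a])
  interpret P: pair_sigma_finite N lborel ..
  interpret P': pair_sigma_finite lborel N ..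
  have [measurable_cong, simp]: "sets N = sets borel" and [simp]: "space N = UNIV" by (simp_all add: N_def)
  have pos: "AE t in N. t > 0" unfolding N_def by (rule AE_half_measure)
  define \<phi> :: "real \<Rightarrow> ennreal" where "\<phi> z = ennreal (indicator {0<..} z * ((f' z)\<^sup>2 / (2 * z)))" for z
  \<comment> \<open>For positive arguments the first two terms give x^2 - y^2 on y <= z < x and the
    last two give y^2 - x^2 on x <= z < y. Truncation by \<open>ennreal\<close> supplies the half of
    each condition that the indicators omit.\<close>
  define k :: "real \<Rightarrow> real \<Rightarrow> real \<Rightarrow> ennreal" where
    "k x y z = ennreal (x\<^sup>2 - z\<^sup>2) * indicator {y..} z + ennreal (z\<^sup>2 - y\<^sup>2) * indicator {..<x} z
      + ennreal (y\<^sup>2 - z\<^sup>2) * indicator {x..} z + ennreal (z\<^sup>2 - x\<^sup>2) * indicator {..<y} z" for x y z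
  have k_ind: "k x y z = ennreal (x\<^sup>2 - z\<^sup>2) * indicator {..z} y + ennreal (z\<^sup>2 - y\<^sup>2) * indicator {z<..} x
      + ennreal (y\<^sup>2 - z\<^sup>2) * indicator {..z} x + ennreal (z\<^sup>2 - x\<^sup>2) * indicator {z<..} y" for x y z
    unfolding k_def by (simp add: indicator_def)
  have [measurable]: "\<phi> \<in> borel_measurable borel"
    unfolding \<phi>_def by measurable
  have k_meas [measurable (raw)]: "(\<lambda>w. k (g w) (h w) (r w)) \<in> borel_measurable L"
    if [measurable]: "g \<in> borel_measurable L" "h \<in> borel_measurable L" "r \<in> borel_measurable L"
    for g h r and L :: "'z measure"
  proof -
    have "(\<lambda>w. k (g w) (h w) (r w)) = (\<lambda>w. ennreal ((g w)\<^sup>2 - (r w)\<^sup>2) * (if h w \<le> r w then 1 else 0)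
      + ennreal ((r w)\<^sup>2 - (h w)\<^sup>2) * (if r w < g w then 1 else 0)
      + ennreal ((h w)\<^sup>2 - (r w)\<^sup>2) * (if g w \<le> r w then 1 else 0)
      + ennreal ((r w)\<^sup>2 - (g w)\<^sup>2) * (if r w < h w then 1 else 0))"
      unfolding k_def by (auto simp: fun_eq_iff indicator_def)
    then show ?thesis by (simp only:) measurable
  qed
  have lt: "ennreal ((f x - f y)\<^sup>2) \<le> (\<integral>\<^sup>+z. \<phi> z * k x y z \<partial>lborel)" if "0 < y" "y < x" for x y
  proof -
    have "ennreal ((f x - f y)\<^sup>2)
        \<le> ennreal (x\<^sup>2 - y\<^sup>2) * (\<integral>\<^sup>+z. ennreal ((f' z)\<^sup>2 / (2 * z)) * indicator {y..x} z \<partial>lborel)"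
      by (rule nn_integral_cauchy_schwarz_square[OF that der cont])
    also have "\<dots> = (\<integral>\<^sup>+z. ennreal (x\<^sup>2 - y\<^sup>2) * (ennreal ((f' z)\<^sup>2 / (2 * z)) * indicator {y..x} z) \<partial>lborel)"
      by (rule nn_integral_cmult[symmetric]) measurable
    also have "\<dots> \<le> (\<integral>\<^sup>+z. \<phi> z * k x y z \<partial>lborel)"
    proof (rule nn_integral_mono_AE)
      show "AE z in lborel. ennreal (x\<^sup>2 - y\<^sup>2) * (ennreal ((f' z)\<^sup>2 / (2 * z)) * indicator {y..x} z) \<le> \<phi> z * k x y z"
        \<comment> \<open>The kernel lives on y <= z < x while the Cauchy-Schwarz integral runs over
          the closed interval; the endpoint is a null set.\<close>
        using AE_lborel_singleton[of x]
      proof eventually_elim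
        fix z assume "z \<noteq> x"
        show "ennreal (x\<^sup>2 - y\<^sup>2) * (ennreal ((f' z)\<^sup>2 / (2 * z)) * indicator {y..x} z) \<le> \<phi> z * k x y z"
        proof (cases "y \<le> z \<and> z < x")
          case True
          then have sq: "y\<^sup>2 \<le> z\<^sup>2" "z\<^sup>2 \<le> x\<^sup>2" using that by (auto intro!: power_mono)
          have "ennreal (x\<^sup>2 - y\<^sup>2) = ennreal (x\<^sup>2 - z\<^sup>2) + ennreal (z\<^sup>2 - y\<^sup>2)"
            using sq by (simp add: ennreal_plus[symmetric] del: ennreal_plus)
          also have "\<dots> = k x y z" using True that by (simp add: k_def sq ennreal_neg)
          finally show ?thesis using True that by (simp add: \<phi>_def mult.commute)
        next
          case False
          then show ?thesis using \<open>z \<noteq> x\<close> by (auto simp: indicator_def)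
        qed
      qed
    qed
    finally show ?thesis .
  qed
  have k_sym: "k x y z = k y x z" for x y z unfolding k_def by (simp only: add_ac)
  have pt: "ennreal ((f x - f y)\<^sup>2) \<le> (\<integral>\<^sup>+z. \<phi> z * k x y z \<partial>lborel)" if "0 < x" "0 < y" for x y
  proof (cases x y rule: linorder_cases)
    case less
    then show ?thesis using lt[of x y] that k_sym[of x y] by (simp add: power2_commute[of "f x"])
  qed (use lt[of y x] that in auto)
  have "(\<integral>\<^sup>+y. \<integral>\<^sup>+x. ennreal ((f x - f y)\<^sup>2) \<partial>N \<partial>N) \<le> (\<integral>\<^sup>+y. \<integral>\<^sup>+x. \<integral>\<^sup>+z. \<phi> z * k x y z \<partial>lborel \<partial>N \<partial>N)"
  proof (rule nn_integral_mono_AE, use pos in eventually_elim)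
    fix y :: real assume "0 < y"
    then show "(\<integral>\<^sup>+x. ennreal ((f x - f y)\<^sup>2) \<partial>N) \<le> (\<integral>\<^sup>+x. \<integral>\<^sup>+z. \<phi> z * k x y z \<partial>lborel \<partial>N)"
      by (intro nn_integral_mono_AE) (use pos in eventually_elim, simp add: pt)
  qed
  also have "\<dots> = (\<integral>\<^sup>+y. \<integral>\<^sup>+z. \<integral>\<^sup>+x. \<phi> z * k x y z \<partial>N \<partial>lborel \<partial>N)"
    by (intro nn_integral_cong P'.Fubini') measurable
  also have "\<dots> = (\<integral>\<^sup>+z. \<integral>\<^sup>+y. \<integral>\<^sup>+x. \<phi> z * k x y z \<partial>N \<partial>N \<partial>lborel)"
    by (intro P'.Fubini') measurable
  also have "\<dots> = (\<integral>\<^sup>+z. ennreal (indicator {0<..} z * half_weight s a z / half_mass s a) * (ennreal s * ennreal ((f' z)\<^sup>2)) \<partial>lborel)"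
  proof (rule nn_integral_cong)
    fix z :: real
    define A where "A = (\<integral>\<^sup>+x. ennreal (x\<^sup>2 - z\<^sup>2) \<partial>N)"
    define B where "B = (\<integral>\<^sup>+x. ennreal (z\<^sup>2 - x\<^sup>2) \<partial>N)"
    have x: "(\<integral>\<^sup>+x. k x y z \<partial>N) = A * indicator {..z} y + ennreal (z\<^sup>2 - y\<^sup>2) * emeasure N {z<..}
        + ennreal (y\<^sup>2 - z\<^sup>2) * emeasure N {..z} + B * indicator {z<..} y" for y
      unfolding k_ind by (simp add: nn_integral_add nn_integral_cmult nn_integral_multc A_def B_def)
    \<comment> \<open>The two orderings of x and y contribute equally; this 2 cancels the 2 in the
      weight 1/(2z).\<close>
    have y: "(\<integral>\<^sup>+y. \<integral>\<^sup>+x. k x y z \<partial>N \<partial>N) = 2 * (A * emeasure N {..z} + B * emeasure N {z<..})"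
      unfolding x by (simp add: nn_integral_add nn_integral_cmult nn_integral_multc A_def[symmetric] B_def[symmetric])
        (simp only: distrib_left mult_2 add_ac)
    have "(\<integral>\<^sup>+y. \<integral>\<^sup>+x. \<phi> z * k x y z \<partial>N \<partial>N) = \<phi> z * (2 * (A * emeasure N {..z} + B * emeasure N {z<..}))"
      by (subst y[symmetric]) (simp add: nn_integral_cmult)
    also have "\<dots> = ennreal (indicator {0<..} z * half_weight s a z / half_mass s a) * (ennreal s * ennreal ((f' z)\<^sup>2))"
    proof (cases "z > 0")
      case True
      have Z: "half_mass s a > 0" by (rule half_mass_pos[OF s a])
      have *: "A * emeasure N {..z} + B * emeasure N {z<..} = ennreal (s * (z * half_weight s a z) / half_mass s a)"
        unfolding A_def B_def N_def by (rule half_measure_kernel[OF s a True])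
      then have "\<phi> z * (2 * (A * emeasure N {..z} + B * emeasure N {z<..}))
          = ennreal ((f' z)\<^sup>2 / (2 * z) * (2 * (s * (z * half_weight s a z) / half_mass s a)))"
      proof -
        have e: "ennreal p * (2 * ennreal r) = ennreal (p * (2 * r))" if "0 \<le> p" "0 \<le> r" for p r
          using that by (simp add: ennreal_mult)
        have "0 \<le> s * (z * half_weight s a z) / half_mass s a" using True s Z by simp
        moreover have "0 \<le> (f' z)\<^sup>2 / (2 * z)" using True by simp
        moreover have "\<phi> z = ennreal ((f' z)\<^sup>2 / (2 * z))" using True by (simp add: \<phi>_def)
        ultimately show ?thesis using * by (simp only: e)
      qed
      also have "(f' z)\<^sup>2 / (2 * z) * (2 * (s * (z * half_weight s a z) / half_mass s a))
          = half_weight s a z / half_mass s a * (s * (f' z)\<^sup>2)"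
        using True by simp
      also have "ennreal \<dots> = ennreal (half_weight s a z / half_mass s a) * (ennreal s * ennreal ((f' z)\<^sup>2))"
      proof -
        have e: "ennreal (p * (q * r)) = ennreal p * (ennreal q * ennreal r)" if "0 \<le> p" "0 \<le> q" "0 \<le> r" for p q r
          using that by (simp add: ennreal_mult)
        show ?thesis by (rule e) (use s Z in auto)
      qed
      finally show ?thesis using True by simp
    qed (simp add: \<phi>_def)
    finally show "(\<integral>\<^sup>+y. \<integral>\<^sup>+x. \<phi> z * k x y z \<partial>N \<partial>N) = \<dots>" .
  qed
  also have "\<dots> = (\<integral>\<^sup>+z. ennreal s * ennreal ((f' z)\<^sup>2) \<partial>N)"
    unfolding N_def by (subst nn_integral_half_measure) auto
  also have "\<dots> = ennreal s * (\<integral>\<^sup>+z. ennreal ((f' z)\<^sup>2) \<partial>N)"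
    by (rule nn_integral_cmult) measurable
  finally show ?thesis .
qed

lemma half_measure_poincare:
  fixes f f' :: "real \<Rightarrow> real"
  assumes s: "s > 0" and a: "a \<ge> 0"
    and der: "\<And>t. t > 0 \<Longrightarrow> (f has_real_derivative f' t) (at t)"
    and cont: "continuous_on {0<..} f'" and meas: "f' \<in> borel_measurable borel"
    and int: "integrable (half_measure s a) f" "integrable (half_measure s a) (\<lambda>t. (f t)\<^sup>2)"
      "integrable (half_measure s a) (\<lambda>t. (f' t)\<^sup>2)"
  shows "2 * ((\<integral>t. (f t)\<^sup>2 \<partial>half_measure s a) - (\<integral>t. f t \<partial>half_measure s a)\<^sup>2)
    \<le> s * (\<integral>t. (f' t)\<^sup>2 \<partial>half_measure s a)"
proof -
  let ?N = "half_measure s a"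
  interpret prob_space ?N by (rule prob_space_half_measure[OF s a])
  define u where "u = (\<integral>t. f t \<partial>?N)"
  define v where "v = (\<integral>t. (f t)\<^sup>2 \<partial>?N)"
  have sq: "(f x - f y)\<^sup>2 = (f x)\<^sup>2 + (f y)\<^sup>2 - 2 * f y * f x" for x y
    by (simp add: power2_eq_square algebra_simps)
  have inner: "(\<integral>\<^sup>+x. ennreal ((f x - f y)\<^sup>2) \<partial>?N) = ennreal (v + (f y)\<^sup>2 - 2 * u * f y)" for y
  proof -
    have "(\<integral>\<^sup>+x. ennreal ((f x - f y)\<^sup>2) \<partial>?N) = ennreal (\<integral>x. (f x - f y)\<^sup>2 \<partial>?N)"
    proof (rule nn_integral_eq_integral)
      show "integrable ?N (\<lambda>x. (f x - f y)\<^sup>2)" unfolding sq using int by auto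
    qed simp
    also have "(\<integral>x. (f x - f y)\<^sup>2 \<partial>?N) = v + (f y)\<^sup>2 - 2 * u * f y"
      unfolding sq using int by (simp add: u_def v_def prob_space[simplified] mult.commute)
    finally show ?thesis .
  qed
  have nn: "0 \<le> v + (f y)\<^sup>2 - 2 * u * f y" for y
  proof -
    have "0 \<le> (f y - u)\<^sup>2 + (v - u\<^sup>2)"
      unfolding u_def v_def using square_integral_le[OF int(1,2)] by simp
    then show ?thesis by (simp add: power2_eq_square algebra_simps)
  qed
  have "(\<integral>\<^sup>+y. \<integral>\<^sup>+x. ennreal ((f x - f y)\<^sup>2) \<partial>?N \<partial>?N) = ennreal (\<integral>y. v + (f y)\<^sup>2 - 2 * u * f y \<partial>?N)"
    unfolding inner using int nn by (intro nn_integral_eq_integral) auto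
  also have "(\<integral>y. v + (f y)\<^sup>2 - 2 * u * f y \<partial>?N) = v + v - 2 * u * u"
    using int by (simp add: u_def[symmetric] v_def[symmetric] prob_space[simplified])
  also have "\<dots> = 2 * (v - u\<^sup>2)"
    by (simp add: power2_eq_square)
  finally have "ennreal (2 * (v - u\<^sup>2)) \<le> ennreal s * (\<integral>\<^sup>+z. ennreal ((f' z)\<^sup>2) \<partial>?N)"
    using half_measure_poincare_nn[OF s a der cont meas] by simp
  also have "\<dots> = ennreal (s * (\<integral>t. (f' t)\<^sup>2 \<partial>?N))"
    using s int(3) by (subst nn_integral_eq_integral) (auto simp: ennreal_mult')
  finally show ?thesis
    unfolding u_def v_def using s by (subst (asm) ennreal_le_iff) auto
qed

section \<open>The Gaussian measure\<close>

text \<open>The centred Gaussian of variance s. Normalising by \<open>2 * half_mass s 0\<close>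
  makes it the average of \<open>half_measure s 0\<close> and its reflection, so that no closed form
  of the constant enters.\<close>

definition gauss :: "real \<Rightarrow> real measure" where
  "gauss s = density lborel (\<lambda>t. ennreal (exp (- t\<^sup>2 / (2 * s)) / (2 * half_mass s 0)))"

lemma sets_gauss [simp, measurable_cong]: "sets (gauss s) = sets borel"
  by (simp add: gauss_def)

lemma space_gauss [simp]: "space (gauss s) = UNIV"
  by (simp add: gauss_def)

lemma
  fixes f :: "real \<Rightarrow> real"
  assumes s: "s > 0" and meas [measurable]: "f \<in> borel_measurable borel"
    and int: "integrable (half_measure s 0) f" "integrable (half_measure s 0) (\<lambda>t. f (- t))"
  shows integrable_gauss: "integrable (gauss s) f"
    and integral_gauss: "(\<integral>t. f t \<partial>gauss s)
      = ((\<integral>t. f t \<partial>half_measure s 0) + (\<integral>t. f (- t) \<partial>half_measure s 0)) / 2"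
    and integral_gauss_lborel: "(\<integral>t. f t \<partial>gauss s)
      = (\<integral>t. exp (- t\<^sup>2 / (2 * s)) * f t \<partial>lborel) / (2 * half_mass s 0)"
    and integrable_gauss_lborel: "integrable lborel (\<lambda>t. exp (- t\<^sup>2 / (2 * s)) * f t)"
proof -
  let ?w = "\<lambda>t::real. exp (- t\<^sup>2 / (2 * s))"
  let ?g = "\<lambda>f t. indicator {0<..} t * (half_weight s 0 t * f t) :: real"
  have Z: "half_mass s 0 > 0" by (rule half_mass_pos[OF s]) simp
  have i1: "integrable lborel (?g f)" and i2: "integrable lborel (?g (\<lambda>t. f (- t)))"
    using int s by (simp_all add: integrable_half_measure_iff)
  have i3: "integrable lborel (\<lambda>t. ?g (\<lambda>t. f (- t)) (- t))"
    using lborel_integrable_real_affine[OF i2, of "-1" 0] by simp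
  have I3: "(\<integral>t. ?g (\<lambda>t. f (- t)) (- t) \<partial>lborel) = (\<integral>t. ?g (\<lambda>t. f (- t)) t \<partial>lborel)"
    using lborel_integral_real_affine[of "-1" "?g (\<lambda>t. f (- t))" 0] by simp
  \<comment> \<open>The origin lies in neither open half line, so the identity is claimed only away
    from t = 0.\<close>
  have ae: "AE t in lborel. ?g f t + ?g (\<lambda>t. f (- t)) (- t) = ?w t * f t"
    using AE_lborel_singleton[of 0]
    by eventually_elim (auto simp: half_weight_def indicator_def)
  show i: "integrable lborel (\<lambda>t. ?w t * f t)"
    using Bochner_Integration.integrable_add[OF i1 i3] ae
    by (subst (asm) integrable_cong_AE) auto
  have "(\<integral>t. ?w t * f t \<partial>lborel) = (\<integral>t. ?g f t + ?g (\<lambda>t. f (- t)) (- t) \<partial>lborel)"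
    using ae by (intro integral_cong_AE) auto
  also have "\<dots> = (\<integral>t. ?g f t \<partial>lborel) + (\<integral>t. ?g (\<lambda>t. f (- t)) t \<partial>lborel)"
    using i1 i3 I3 by simp
  finally have I: "(\<integral>t. ?w t * f t \<partial>lborel) = (\<integral>t. ?g f t \<partial>lborel) + (\<integral>t. ?g (\<lambda>t. f (- t)) t \<partial>lborel)" .
  have "integrable lborel (\<lambda>t. ?w t / (2 * half_mass s 0) * f t)"
    using integrable_mult_right[OF i, of "1 / (2 * half_mass s 0)"] by simp
  then show "integrable (gauss s) f"
    unfolding gauss_def using Z by (subst integrable_density) auto
  have "(\<integral>t. f t \<partial>gauss s) = (\<integral>t. (?w t * f t) / (2 * half_mass s 0) \<partial>lborel)"
    unfolding gauss_def using Z by (subst integral_density) auto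
  then show J: "(\<integral>t. f t \<partial>gauss s) = (\<integral>t. ?w t * f t \<partial>lborel) / (2 * half_mass s 0)"
    by simp
  show "(\<integral>t. f t \<partial>gauss s)
      = ((\<integral>t. f t \<partial>half_measure s 0) + (\<integral>t. f (- t) \<partial>half_measure s 0)) / 2"
    unfolding J I using s by (simp add: integral_half_measure add_divide_distrib)
qed

lemma prob_space_gauss:
  assumes "s > 0" shows "prob_space (gauss s)"
proof
  interpret N: prob_space "half_measure s 0" using assms by (intro prob_space_half_measure) auto
  have Z: "half_mass s 0 > 0" using assms by (intro half_mass_pos) auto
  have i: "integrable lborel (\<lambda>t. exp (- t\<^sup>2 / (2 * s)) * 1 / (2 * half_mass s 0))"
    using integrable_gauss_lborel[OF assms, of "\<lambda>_. 1"] by simp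
  have "emeasure (gauss s) UNIV = (\<integral>\<^sup>+t. ennreal (exp (- t\<^sup>2 / (2 * s)) * 1 / (2 * half_mass s 0)) \<partial>lborel)"
    unfolding gauss_def by (subst emeasure_density) auto
  also have "\<dots> = ennreal (\<integral>t. exp (- t\<^sup>2 / (2 * s)) * 1 / (2 * half_mass s 0) \<partial>lborel)"
    using Z by (intro nn_integral_eq_integral i) auto
  also have "\<dots> = ennreal (\<integral>t. 1 \<partial>gauss s)"
    using integral_gauss_lborel[OF assms, of "\<lambda>_. 1"] by simp
  also have "\<dots> = 1"
    using integral_gauss[OF assms, of "\<lambda>_. 1"] by (simp add: N.prob_space[simplified])
  finally show "emeasure (gauss s) (space (gauss s)) = 1" by simp
qed

lemma half_measure_integrable_id:
  assumes "s > 0" "a \<ge> 0"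
  shows "integrable (half_measure s a) (\<lambda>t. t)"
  using finite_measure.square_integrable_imp_integrable[OF
      prob_space.finite_measure[OF prob_space_half_measure[OF assms]] _ half_measure_square_integrable[OF assms]]
  by simp

lemma
  assumes "s > 0"
  shows gauss_square_integrable: "integrable (gauss s) (\<lambda>t. t\<^sup>2)"
    and gauss_mean: "(\<integral>t. t \<partial>gauss s) = 0"
    and gauss_variance: "(\<integral>t. t\<^sup>2 \<partial>gauss s) = s"
proof -
  have i: "integrable (half_measure s 0) (\<lambda>t. t\<^sup>2)" "integrable (half_measure s 0) (\<lambda>t. t)"
    using assms half_measure_square_integrable[of s 0] half_measure_integrable_id[of s 0] by auto
  have m: "(\<lambda>t::real. t\<^sup>2) \<in> borel_measurable borel" by measurable
  show "integrable (gauss s) (\<lambda>t. t\<^sup>2)"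
    by (rule integrable_gauss[OF assms m i(1)]) (simp add: i(1))
  have "(\<integral>t. t \<partial>gauss s) = ((\<integral>t. t \<partial>half_measure s 0) + (\<integral>t. - t \<partial>half_measure s 0)) / 2"
    by (rule integral_gauss[OF assms _ i(2) Bochner_Integration.integrable_minus[OF i(2)]]) measurable
  then show "(\<integral>t. t \<partial>gauss s) = 0" by simp
  have "(\<integral>t. t\<^sup>2 \<partial>gauss s) = ((\<integral>t. t\<^sup>2 \<partial>half_measure s 0) + (\<integral>t. (- t)\<^sup>2 \<partial>half_measure s 0)) / 2"
    by (rule integral_gauss[OF assms m i(1)]) (simp add: i(1))
  then show "(\<integral>t. t\<^sup>2 \<partial>gauss s) = s"
    using assms half_measure_second_moment[of s 0] by simp
qed

lemma bcont_minus: "bcont f \<Longrightarrow> bcont (\<lambda>t::real. f (- t))"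
  by (erule bcont_compose) (intro continuous_intros)

lemma bcont_half_measure_integrable:
  assumes "s > 0" "a \<ge> 0" "bcont f" shows "integrable (half_measure s a) f"
  using prob_space_half_measure[OF assms(1,2)] by (intro bcont_integrable assms) (auto simp: prob_space.finite_measure)

text \<open>Stein's identity: -s times the Gaussian weight times h is an antiderivative of the
  difference of the two integrands, and it vanishes at both ends because h is bounded.\<close>

lemma gauss_parts:
  assumes s: "s > 0" and h: "C1b_real h h'"
  shows "(\<integral>t. t * h t \<partial>gauss s) = s * (\<integral>t. h' t \<partial>gauss s)"
proof -
  let ?N = "half_measure s 0"
  let ?w = "\<lambda>t::real. exp (- t\<^sup>2 / (2 * s))"
  have bh: "bcont h" and bh': "bcont h'" and der: "\<And>t. (h has_real_derivative h' t) (at t)"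
    using h unfolding C1b_real_def by auto
  have ch: "continuous_on UNIV h" and ch': "continuous_on UNIV h'"
    using bh bh' unfolding bcont_def by auto
  have [measurable]: "h \<in> borel_measurable borel" "h' \<in> borel_measurable borel"
    using bcont_measurable[OF bh refl] bcont_measurable[OF bh' refl] by auto
  obtain B where B: "\<And>t. \<bar>h t\<bar> \<le> B" using bh by (metis bcontE)
  have i1: "integrable ?N (\<lambda>t. t * h t)" "integrable ?N (\<lambda>t. - t * h (- t))"
    using s half_measure_integrable_id[of s 0]
      bcont_integrable_mult[OF bh, of ?N "\<lambda>t. t"] bcont_integrable_mult[OF bcont_minus[OF bh], of ?N "\<lambda>t. t"] by auto
  have i2: "integrable ?N h'" "integrable ?N (\<lambda>t. h' (- t))"
    using s bh' bcont_minus[OF bh'] by (auto intro: bcont_half_measure_integrable)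
  let ?f = "\<lambda>t. ?w t * (t * h t) - s * (?w t * h' t)"
  have i3: "integrable lborel (\<lambda>t. ?w t * (t * h t))"
    by (rule integrable_gauss_lborel[OF s]) (use i1 in auto)
  have i4: "integrable lborel (\<lambda>t. ?w t * h' t)"
    by (rule integrable_gauss_lborel[OF s]) (use i2 in auto)
  have lim: "((\<lambda>t. - s * (?w t * h t)) \<longlongrightarrow> 0) F" if w: "(?w \<longlongrightarrow> 0) F" for F
  proof (rule Lim_null_comparison)
    show "((\<lambda>t. s * ?w t * B) \<longlongrightarrow> 0) F"
      using tendsto_mult_left_zero[OF tendsto_mult_right_zero[OF w, of s], of B] .
    have "\<bar>?w t * h t\<bar> \<le> ?w t * B" for t
      unfolding abs_mult using B by (simp add: mult_left_mono)
    then show "\<forall>\<^sub>F t in F. norm (- s * (?w t * h t)) \<le> s * ?w t * B"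
      using s by (auto simp: abs_mult mult.assoc intro!: always_eventually mult_left_mono)
  qed
  have "(LBINT t=-\<infinity>..\<infinity>. ?f t) = 0 - 0"
  proof (rule interval_integral_FTC_integrable)
    show "((\<lambda>t. - s * (?w t * h t)) has_vector_derivative ?f t) (at t)" for t
      unfolding has_real_derivative_iff_has_vector_derivative[symmetric]
      using s by (auto intro!: derivative_eq_intros der simp: field_simps)
    show "isCont ?f t" for t
      using ch ch' s by (intro continuous_intros) (auto simp: continuous_on_eq_continuous_at)
    show "set_integrable lborel (einterval (-\<infinity>) \<infinity>) ?f"
      using i3 i4 by (simp add: set_integrable_def)
    have "(?w \<longlongrightarrow> 0) at_bot" using s by real_asymp
    moreover have "(?w \<longlongrightarrow> 0) at_top" using s by real_asymp
    ultimately have "((\<lambda>t. - s * (?w t * h t)) \<longlongrightarrow> 0) at_bot" "((\<lambda>t. - s * (?w t * h t)) \<longlongrightarrow> 0) at_top"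
      using lim by blast+
    then    show "(((\<lambda>t. - s * (?w t * h t)) \<circ> real_of_ereal) \<longlongrightarrow> 0) (at_right (-\<infinity>))"
      "(((\<lambda>t. - s * (?w t * h t)) \<circ> real_of_ereal) \<longlongrightarrow> 0) (at_left \<infinity>)"
      by (simp_all add: ereal_tendsto_simps)
  qed simp
  then have "(\<integral>t. ?f t \<partial>lborel) = 0"
    by (simp add: interval_lebesgue_integral_def set_lebesgue_integral_def)
  then have "(\<integral>t. ?w t * (t * h t) \<partial>lborel) = s * (\<integral>t. ?w t * h' t \<partial>lborel)"
    using i3 i4 by simp
  moreover have "(\<integral>t. t * h t \<partial>gauss s) = (\<integral>t. ?w t * (t * h t) \<partial>lborel) / (2 * half_mass s 0)"
    using s i1 by (intro integral_gauss_lborel) auto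
  moreover have "(\<integral>t. h' t \<partial>gauss s) = (\<integral>t. ?w t * h' t \<partial>lborel) / (2 * half_mass s 0)"
    using s i2 by (intro integral_gauss_lborel) auto
  ultimately show ?thesis by simp
qed

section \<open>Odd functions and the Poincare inequality for the Gaussian\<close>

text \<open>\<open>half_measure s 2\<close> has density t^2/s with respect to
  \<open>half_measure s 0\<close>; the constant is the second moment s of the latter.\<close>

lemma
  fixes f :: "real \<Rightarrow> real"
  assumes s: "s > 0" and [measurable]: "f \<in> borel_measurable borel"
  shows integrable_half_measure_2: "integrable (half_measure s 2) f \<longleftrightarrow> integrable (half_measure s 0) (\<lambda>t. t\<^sup>2 * f t)"
    and integral_half_measure_2: "(\<integral>t. f t \<partial>half_measure s 2) = (\<integral>t. t\<^sup>2 * f t \<partial>half_measure s 0) / s"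
proof -
  have Z: "half_mass s 2 > 0" "half_mass s 0 > 0" using s by (auto intro: half_mass_pos)
  have e: "(\<lambda>t. indicator {0<..} t * (half_weight s 2 t * g t))
      = (\<lambda>t. indicator {0<..} t * (half_weight s 0 t * (t\<^sup>2 * g t)))" for g :: "real \<Rightarrow> real"
    using half_weight_mult_square[of _ s 0] by (auto simp: fun_eq_iff indicator_def mult_ac)
  show "integrable (half_measure s 2) f \<longleftrightarrow> integrable (half_measure s 0) (\<lambda>t. t\<^sup>2 * f t)"
    using s by (simp add: integrable_half_measure_iff e)
  interpret N: prob_space "half_measure s 2" using s by (intro prob_space_half_measure) auto
  have "half_mass s 2 = (\<integral>t. indicator {0<..} t * (half_weight s 0 t * (t\<^sup>2 * 1)) \<partial>lborel)"
    unfolding half_mass_def by (subst e[symmetric]) simp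
  also have "\<dots> = half_mass s 0 * (\<integral>t. t\<^sup>2 * 1 \<partial>half_measure s 0)"
    using s Z by (subst integral_half_measure) auto
  finally have "half_mass s 2 = half_mass s 0 * s"
    using s half_measure_second_moment[of s 0] by simp
  then show "(\<integral>t. f t \<partial>half_measure s 2) = (\<integral>t. t\<^sup>2 * f t \<partial>half_measure s 0) / s"
    using s integral_half_measure[of s 2 f] integral_half_measure[of s 0 "\<lambda>t. t\<^sup>2 * f t"] e[of f] by simp
qed

lemma half_measure_poincare_C1b:
  assumes s: "s > 0" and a: "a \<ge> 0" and h: "C1b_real h h'"
  shows "2 * ((\<integral>t. (h t)\<^sup>2 \<partial>half_measure s a) - (\<integral>t. h t \<partial>half_measure s a)\<^sup>2)
    \<le> s * (\<integral>t. (h' t)\<^sup>2 \<partial>half_measure s a)"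
proof -
  have bh: "bcont h" and bh': "bcont h'" and der: "\<And>t. (h has_real_derivative h' t) (at t)"
    using h unfolding C1b_real_def by auto
  show ?thesis
  proof (rule half_measure_poincare[OF s a der])
    show "continuous_on {0<..} h'" using bh' continuous_on_subset unfolding bcont_def by blast
    show "h' \<in> borel_measurable borel" by (rule bcont_measurable[OF bh' refl])
  qed (intro bcont_half_measure_integrable[OF s a] bh bh' bcont_power2)+
qed

text \<open>An odd function r is divided by t: the quotient is integrated against t^2 times the
  Gaussian weight, to which the half-line inequality applies with exponent 2. The boundary terms of
  the integration by parts vanish because r(t) = O(t).\<close>

lemma half_measure_odd_poincare:
  fixes r r' :: "real \<Rightarrow> real"
  assumes s: "s > 0" and r: "C1b_real r r'" and r0: "r 0 = 0"
  shows "3 * (\<integral>t. (r t)\<^sup>2 \<partial>half_measure s 0)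
    \<le> s * (\<integral>t. (r' t)\<^sup>2 \<partial>half_measure s 0) + 2 * (\<integral>t. t * r t \<partial>half_measure s 0)\<^sup>2 / s"
proof -
  let ?N = "half_measure s 0"
  let ?w = "\<lambda>t::real. exp (- t\<^sup>2 / (2 * s))"
  interpret N: prob_space ?N using s by (intro prob_space_half_measure) auto
  have br: "bcont r" and br': "bcont r'" and der: "\<And>t. (r has_real_derivative r' t) (at t)"
    using r unfolding C1b_real_def by auto
  have [measurable]: "r \<in> borel_measurable borel" "r' \<in> borel_measurable borel"
    using bcont_measurable[OF br refl] bcont_measurable[OF br' refl] by auto
  obtain C where C: "\<And>t. \<bar>r' t\<bar> \<le> C" using br' by (metis bcontE)
  have rC: "\<bar>r t\<bar> \<le> C * t" if "t > 0" for t
  proof -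
    have "norm (r t - r 0) \<le> C * norm (t - 0)"
      by (rule field_differentiable_bound[OF convex_UNIV]) (use der C in auto)
    then show ?thesis using that r0 by simp
  qed
  define q where "q t = r t / t" for t
  define q' where "q' t = (r' t - q t) / t" for t
  have [measurable]: "q \<in> borel_measurable borel" "q' \<in> borel_measurable borel"
    unfolding q_def q'_def by measurable
  have qC: "\<bar>q t\<bar> \<le> C" if "t > 0" for t
    using rC[OF that] that by (simp add: q_def divide_le_eq)
  have C0: "0 \<le> C" using C[of 0] by simp
  have cr: "continuous_on {0<..} r" and cr': "continuous_on {0<..} r'"
    using br br' continuous_on_subset unfolding bcont_def by blast+
  have cq: "continuous_on {0<..} q"
    unfolding q_def by (intro continuous_intros cr) auto
  have ae: "AE t in ?N. t > 0" by (rule AE_half_measure)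
  have ib: "integrable ?N f" if "f \<in> borel_measurable borel" "\<And>t. t > 0 \<Longrightarrow> \<bar>f t\<bar> \<le> B" for f and B :: real
    by (rule N.integrable_const_bound[of _ B]) (use ae that in \<open>auto elim!: AE_mp\<close>)
  have iq2: "integrable ?N (\<lambda>t. (q t)\<^sup>2)"
    by (rule ib[of _ "C\<^sup>2"]) (use qC in \<open>auto simp: abs_le_square_iff[symmetric] C0\<close>)
  have ir'q: "integrable ?N (\<lambda>t. r' t * q t)"
    by (rule ib[of _ "C * C"]) (use qC C C0 in \<open>auto simp: abs_mult intro!: mult_mono\<close>)
  have ir2: "integrable ?N (\<lambda>t. (r t)\<^sup>2)" and ir'2: "integrable ?N (\<lambda>t. (r' t)\<^sup>2)"
    using s by (auto intro!: bcont_half_measure_integrable bcont_power2 br br')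
  have itr: "integrable ?N (\<lambda>t. t * r t)"
    using s half_measure_integrable_id[of s 0] by (intro bcont_integrable_mult br) auto
  \<comment> \<open>Times the Gaussian weight, \<open>f\<close> is the derivative of
    \<open>F\<close>, so its integral vanishes. This eliminates the cross term E (r' q) in favour of
    E q^2 and E r^2.\<close>
  define f where "f t = 2 * (r' t * q t) - (q t)\<^sup>2 - (r t)\<^sup>2 / s" for t
  have if': "integrable ?N f" unfolding f_def using iq2 ir'q ir2 by auto
  have [measurable]: "f \<in> borel_measurable borel" unfolding f_def by measurable
  define F where "F t = (r t)\<^sup>2 / t * ?w t" for t
  have lim: "(F \<longlongrightarrow> 0) G" if "\<forall>\<^sub>F t in G. t > 0" "((\<lambda>t. t * ?w t) \<longlongrightarrow> 0) G" for G
  proof (rule Lim_null_comparison)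
    show "((\<lambda>t. C\<^sup>2 * (t * ?w t)) \<longlongrightarrow> 0) G" by (rule tendsto_mult_right_zero[OF that(2)])
    have "norm (F t) \<le> C\<^sup>2 * (t * ?w t)" if "t > 0" for t
    proof -
      have "(r t)\<^sup>2 \<le> (C * t)\<^sup>2" using rC[OF that] C0 that by (simp add: abs_le_square_iff[symmetric])
      then have "(r t)\<^sup>2 / t \<le> C\<^sup>2 * t" using that by (simp add: divide_le_eq power2_eq_square mult_ac)
      then have "(r t)\<^sup>2 / t * ?w t \<le> C\<^sup>2 * t * ?w t" by (intro mult_right_mono) auto
      then show ?thesis using that by (simp add: F_def mult.assoc)
    qed
    with that(1) show "\<forall>\<^sub>F t in G. norm (F t) \<le> C\<^sup>2 * (t * ?w t)" by (rule eventually_mono)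
  qed
  have "(LBINT t=ereal 0..\<infinity>. ?w t * f t) = 0 - 0"
  proof (rule interval_integral_FTC_integrable)
    show "(F has_vector_derivative ?w t * f t) (at t)" if "ereal 0 < ereal t" for t
    proof -
      have w: "(?w has_real_derivative ?w t * (- t / s)) (at t)"
        using s by (auto intro!: derivative_eq_intros simp: field_simps)
      have r2: "((\<lambda>t. (r t)\<^sup>2 / t) has_real_derivative 2 * r t * r' t / t - (r t)\<^sup>2 / t\<^sup>2) (at t)"
        using that by (auto intro!: derivative_eq_intros der simp: field_simps power2_eq_square)
      have "(F has_real_derivative
          (2 * r t * r' t / t - (r t)\<^sup>2 / t\<^sup>2) * ?w t + ?w t * (- t / s) * ((r t)\<^sup>2 / t)) (at t)"
        unfolding F_def by (rule DERIV_mult[OF r2 w])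
      also have "(2 * r t * r' t / t - (r t)\<^sup>2 / t\<^sup>2) * ?w t + ?w t * (- t / s) * ((r t)\<^sup>2 / t)
          = ?w t * (2 * r t * r' t / t - (r t)\<^sup>2 / t\<^sup>2 - t / s * ((r t)\<^sup>2 / t))"
        by (simp add: algebra_simps)
      also have "\<dots> = ?w t * f t"
        unfolding f_def q_def using that by (simp add: power_divide mult_ac)
      finally show ?thesis by (simp add: has_real_derivative_iff_has_vector_derivative)
    qed
    show "isCont (\<lambda>t. ?w t * f t) t" if "ereal 0 < ereal t" for t
    proof -
      have "continuous_on {0<..} (\<lambda>t. ?w t * f t)"
        unfolding f_def using s by (intro continuous_intros cr cr' cq) auto
      then show ?thesis using that by (auto simp: continuous_on_eq_continuous_at)
    qed
    have "integrable lborel (\<lambda>t. indicator {0<..} t * (half_weight s 0 t * f t))"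
      using if' s by (simp add: integrable_half_measure_iff)
    then show "set_integrable lborel (einterval (ereal 0) \<infinity>) (\<lambda>t. ?w t * f t)"
      unfolding set_integrable_def
      by (rule Bochner_Integration.integrable_cong[THEN iffD1, rotated -1])
         (auto simp: indicator_def half_weight_def)
    have "(F \<longlongrightarrow> 0) (at_right 0)"
      by (rule lim) (use s in \<open>auto simp: eventually_at_right_less intro!: tendsto_eq_intros\<close>)
    then show "((F \<circ> real_of_ereal) \<longlongrightarrow> 0) (at_right (ereal 0))"
      by (simp only: ereal_tendsto_simps)
    have "((\<lambda>t. t * ?w t) \<longlongrightarrow> 0) at_top" using s by real_asymp
    then have "(F \<longlongrightarrow> 0) at_top" by (intro lim eventually_gt_at_top)
    then show "((F \<circ> real_of_ereal) \<longlongrightarrow> 0) (at_left \<infinity>)"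
      by (simp only: ereal_tendsto_simps)
  qed simp
  moreover have "(LBINT t=ereal 0..\<infinity>. ?w t * f t) = (\<integral>t. indicator {0<..} t * (half_weight s 0 t * f t) \<partial>lborel)"
    unfolding interval_lebesgue_integral_def set_lebesgue_integral_def
    by (auto simp: indicator_def half_weight_def intro!: Bochner_Integration.integral_cong)
  ultimately have "(\<integral>t. f t \<partial>?N) = 0"
    using s by (simp add: integral_half_measure)
  then have parts: "2 * (\<integral>t. r' t * q t \<partial>?N) - (\<integral>t. (q t)\<^sup>2 \<partial>?N) = (\<integral>t. (r t)\<^sup>2 \<partial>?N) / s"
    unfolding f_def using iq2 ir'q ir2 by simp
  have iE: "integrable (half_measure s 2) g" "(\<integral>t. g t \<partial>half_measure s 2) = (\<integral>t. g2 t \<partial>?N) / s"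
    if "g \<in> borel_measurable borel" "integrable ?N g2" "\<And>t. t > 0 \<Longrightarrow> t\<^sup>2 * g t = g2 t" for g g2
  proof -
    have [measurable]: "g \<in> borel_measurable borel" "g2 \<in> borel_measurable borel"
      using that(1,2) by auto
    have e: "AE t in ?N. t\<^sup>2 * g t = g2 t" using ae by eventually_elim (rule that(3))
    have "integrable ?N (\<lambda>t. t\<^sup>2 * g t) \<longleftrightarrow> integrable ?N g2"
      by (rule integrable_cong_AE) (use e in auto)
    then show "integrable (half_measure s 2) g" using that(2) s by (simp add: integrable_half_measure_2)
    have "(\<integral>t. t\<^sup>2 * g t \<partial>?N) = (\<integral>t. g2 t \<partial>?N)"
      by (rule integral_cong_AE) (use e in auto)
    then show "(\<integral>t. g t \<partial>half_measure s 2) = (\<integral>t. g2 t \<partial>?N) / s"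
      using s by (simp add: integral_half_measure_2)
  qed
  have i': "integrable ?N (\<lambda>t. (r' t)\<^sup>2 - 2 * (r' t * q t) + (q t)\<^sup>2)"
    using ir'2 ir'q iq2 by auto
  have 1: "t\<^sup>2 * q t = t * r t" "t\<^sup>2 * (q t)\<^sup>2 = (r t)\<^sup>2"
      "t\<^sup>2 * (q' t)\<^sup>2 = (r' t)\<^sup>2 - 2 * (r' t * q t) + (q t)\<^sup>2" if "t > 0" for t
  proof -
    show "t\<^sup>2 * q t = t * r t" "t\<^sup>2 * (q t)\<^sup>2 = (r t)\<^sup>2"
      using that by (simp_all add: q_def power2_eq_square)
    have "t * q' t = r' t - q t" using that by (simp add: q'_def)
    then have "t\<^sup>2 * (q' t)\<^sup>2 = (r' t - q t)\<^sup>2" by (simp flip: power_mult_distrib)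
    then show "t\<^sup>2 * (q' t)\<^sup>2 = (r' t)\<^sup>2 - 2 * (r' t * q t) + (q t)\<^sup>2"
      by (simp add: power2_eq_square algebra_simps)
  qed
  note I1 = iE[OF _ itr 1(1)] and I2 = iE[OF _ ir2 1(2)] and I3 = iE[OF _ i' 1(3)]
  have "2 * ((\<integral>t. (q t)\<^sup>2 \<partial>half_measure s 2) - (\<integral>t. q t \<partial>half_measure s 2)\<^sup>2)
    \<le> s * (\<integral>t. (q' t)\<^sup>2 \<partial>half_measure s 2)"
  proof (rule half_measure_poincare[OF s])
    show "(q has_real_derivative q' t) (at t)" if "t > 0" for t
      unfolding q_def[abs_def] q'_def using that
      by (auto intro!: derivative_eq_intros der simp: field_simps power2_eq_square q_def)
    show "continuous_on {0<..} q'"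
      unfolding q'_def by (intro continuous_intros cr' cq) auto
  qed (use I1(1) I2(1) I3(1) in auto)
  then have "2 * ((\<integral>t. (r t)\<^sup>2 \<partial>?N) / s - ((\<integral>t. t * r t \<partial>?N) / s)\<^sup>2)
    \<le> (\<integral>t. (r' t)\<^sup>2 - 2 * (r' t * q t) + (q t)\<^sup>2 \<partial>?N)"
    using I1(2) I2(2) I3(2) s by simp
  also have "\<dots> = (\<integral>t. (r' t)\<^sup>2 \<partial>?N) - (\<integral>t. (r t)\<^sup>2 \<partial>?N) / s"
    using ir'2 ir'q iq2 parts by simp
  \<comment> \<open>The 3 is 2 + 1: the half-line gap contributes 2, and E (t q')^2 = E r'^2 - E r^2
    / s contributes 1. It matches the cubic Hermite mode, the first odd one beyond t.\<close>
  finally have "3 * ((\<integral>t. (r t)\<^sup>2 \<partial>?N) / s) \<le> (\<integral>t. (r' t)\<^sup>2 \<partial>?N) + 2 * ((\<integral>t. t * r t \<partial>?N) / s)\<^sup>2"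
    by simp
  then have "s * (3 * ((\<integral>t. (r t)\<^sup>2 \<partial>?N) / s)) \<le> s * ((\<integral>t. (r' t)\<^sup>2 \<partial>?N) + 2 * ((\<integral>t. t * r t \<partial>?N) / s)\<^sup>2)"
    using s by (intro mult_left_mono) auto
  then show ?thesis using s by (simp add: distrib_left power_divide power2_eq_square)
qed

lemma gauss_poincare:
  assumes s: "s > 0" and h: "C1b_real h h'"
  shows "2 * ((\<integral>t. (h t)\<^sup>2 \<partial>gauss s) - (\<integral>t. h t \<partial>gauss s)\<^sup>2)
    \<le> s * ((\<integral>t. (h' t)\<^sup>2 \<partial>gauss s) + (\<integral>t. h' t \<partial>gauss s)\<^sup>2)"
proof -
  let ?N = "half_measure s 0"
  let ?E = "\<lambda>f. \<integral>t. f t \<partial>?N"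
  interpret N: prob_space ?N using s by (intro prob_space_half_measure) auto
  have bh: "bcont h" and bh': "bcont h'" and der: "\<And>t. (h has_real_derivative h' t) (at t)"
    using h unfolding C1b_real_def by auto
  have der': "((\<lambda>t. h (- t)) has_real_derivative - h' (- t)) (at t)" for t
    using DERIV_chain2[where f = h and g = uminus, OF der DERIV_minus[OF DERIV_ident]] by simp
  have b_lin: "bcont (\<lambda>t. (f t + c * g t) / 2)" if fg: "bcont f" "bcont g" for f g :: "real \<Rightarrow> real" and c
  proof -
    obtain A where f: "continuous_on UNIV f" "\<And>t. \<bar>f t\<bar> \<le> A" using fg(1) by (metis bcontE)
    obtain B where g: "continuous_on UNIV g" "\<And>t. \<bar>g t\<bar> \<le> B" using fg(2) by (metis bcontE)
    have "\<bar>(f t + c * g t) / 2\<bar> \<le> (A + \<bar>c\<bar> * B) / 2" for t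
      using abs_triangle_ineq[of "f t" "c * g t"] f(2)[of t] mult_left_mono[OF g(2)[of t], of "\<bar>c\<bar>"]
      by (simp add: abs_mult)
    moreover have "continuous_on UNIV (\<lambda>t. (f t + c * g t) / 2)"
      by (intro continuous_intros f(1) g(1)) simp
    ultimately show ?thesis unfolding bcont_iff by blast
  qed
  \<comment> \<open>Even and odd parts of h. Since \<open>e'\<close> is odd and \<open>r'\<close> is
    even, the Gaussian mean of h' is the half-line mean of \<open>r'\<close> alone; the explicit
    factors 1 and -1 fit \<open>b_lin\<close>.\<close>
  define e where "e t = (h t + 1 * h (- t)) / 2" for t
  define r where "r t = (h t + (-1) * h (- t)) / 2" for t
  define e' where "e' t = (h' t + (-1) * h' (- t)) / 2" for t
  define r' where "r' t = (h' t + 1 * h' (- t)) / 2" for t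
  have b: "bcont e" "bcont r" "bcont e'" "bcont r'"
    unfolding e_def[abs_def] r_def[abs_def] e'_def[abs_def] r'_def[abs_def]
    by (intro b_lin bh bh' bcont_minus)+
  have "C1b_real e e'" and r: "C1b_real r r'"
    unfolding C1b_real_def using b
    by (auto simp: e_def[abs_def] r_def[abs_def] e'_def r'_def intro!: derivative_eq_intros der der')
  note E = half_measure_poincare_C1b[OF s order_refl \<open>C1b_real e e'\<close>]
  note O = half_measure_odd_poincare[OF s r]
  have ib: "integrable ?N f" "integrable ?N (\<lambda>t. f (- t))" if "bcont f" for f
    using s that bcont_minus[OF that] by (auto intro!: bcont_half_measure_integrable)
  have G: "(\<integral>t. f t \<partial>gauss s) = (?E f + ?E (\<lambda>t. f (- t))) / 2" if "bcont f" for f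
    by (rule integral_gauss[OF s bcont_measurable[OF that refl] ib[OF that]])
  have G1: "(\<integral>t. h t \<partial>gauss s) = ?E e" "(\<integral>t. h' t \<partial>gauss s) = ?E r'"
    unfolding G[OF bh] G[OF bh'] e_def r'_def using ib[OF bh] ib[OF bh'] by simp_all
  have G2: "(\<integral>t. (h t)\<^sup>2 \<partial>gauss s) = ?E (\<lambda>t. (e t)\<^sup>2) + ?E (\<lambda>t. (r t)\<^sup>2)"
  proof -
    have "?E (\<lambda>t. (e t)\<^sup>2) + ?E (\<lambda>t. (r t)\<^sup>2) = ?E (\<lambda>t. (e t)\<^sup>2 + (r t)\<^sup>2)"
      using ib(1)[OF bcont_power2[OF b(1)]] ib(1)[OF bcont_power2[OF b(2)]] by simp
    also have "\<dots> = ?E (\<lambda>t. ((h t)\<^sup>2 + (h (- t))\<^sup>2) / 2)"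
    proof -
      have "(e t)\<^sup>2 + (r t)\<^sup>2 = ((h t)\<^sup>2 + (h (- t))\<^sup>2) / 2" for t
        by (simp add: e_def r_def power2_eq_square field_simps)
      then show ?thesis by (simp only:)
    qed
    finally show ?thesis
      unfolding G[OF bcont_power2[OF bh]] using ib[OF bcont_power2[OF bh]] by simp
  qed
  have G3: "(\<integral>t. (h' t)\<^sup>2 \<partial>gauss s) = ?E (\<lambda>t. (e' t)\<^sup>2) + ?E (\<lambda>t. (r' t)\<^sup>2)"
  proof -
    have "?E (\<lambda>t. (e' t)\<^sup>2) + ?E (\<lambda>t. (r' t)\<^sup>2) = ?E (\<lambda>t. (e' t)\<^sup>2 + (r' t)\<^sup>2)"
      using ib(1)[OF bcont_power2[OF b(3)]] ib(1)[OF bcont_power2[OF b(4)]] by simp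
    also have "\<dots> = ?E (\<lambda>t. ((h' t)\<^sup>2 + (h' (- t))\<^sup>2) / 2)"
    proof -
      have "(e' t)\<^sup>2 + (r' t)\<^sup>2 = ((h' t)\<^sup>2 + (h' (- t))\<^sup>2) / 2" for t
        by (simp add: e'_def r'_def power2_eq_square field_simps)
      then show ?thesis by (simp only:)
    qed
    finally show ?thesis
      unfolding G[OF bcont_power2[OF bh']] using ib[OF bcont_power2[OF bh']] by simp
  qed
  \<comment> \<open>Against the odd function t only the odd part of h survives, so Stein's identity
    for h gives the half-line moment of r.\<close>
  have tr: "?E (\<lambda>t. t * r t) = s * ?E r'"
  proof -
    have i: "integrable ?N (\<lambda>t. t * h t)" "integrable ?N (\<lambda>t. - t * h (- t))"
      using s half_measure_integrable_id[of s 0] bcont_integrable_mult[OF bh, of ?N "\<lambda>t. t"]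
        bcont_integrable_mult[OF bcont_minus[OF bh], of ?N "\<lambda>t. t"] by auto
    have m: "(\<lambda>t. t * h t) \<in> borel_measurable borel"
      using bcont_measurable[OF bh refl] by measurable
    have "(\<integral>t. t * h t \<partial>gauss s) = (?E (\<lambda>t. t * h t) + ?E (\<lambda>t. - t * h (- t))) / 2"
      by (rule integral_gauss[OF s m i])
    also have "\<dots> = ?E (\<lambda>t. (t * h t + - t * h (- t)) / 2)"
      using i by simp
    also have "\<dots> = ?E (\<lambda>t. t * r t)"
    proof -
      have "(t * h t + - t * h (- t)) / 2 = t * r t" for t by (simp add: r_def algebra_simps)
      then show ?thesis by (simp only:)
    qed
    finally show ?thesis using gauss_parts[OF s h] G1 by simp
  qed
  \<comment> \<open>Two thirds of the odd estimate give 2/3 s E r'^2 + 4/3 s (E r')^2; Jensen moves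
    the surplus third from the second term to the first.\<close>
  have J: "s * (?E r')\<^sup>2 \<le> s * ?E (\<lambda>t. (r' t)\<^sup>2)"
    using s N.square_integral_le[OF ib(1)[OF b(4)] ib(1)[OF bcont_power2[OF b(4)]]] by simp
  have "2 * ?E (\<lambda>t. (e t)\<^sup>2) - 2 * (?E e)\<^sup>2 \<le> s * ?E (\<lambda>t. (e' t)\<^sup>2)"
    using E by simp
  moreover have "3 * ?E (\<lambda>t. (r t)\<^sup>2) \<le> s * ?E (\<lambda>t. (r' t)\<^sup>2) + 2 * (s * (?E r')\<^sup>2)"
  proof -
    have "r 0 = 0" by (simp add: r_def)
    moreover have "2 * (s * ?E r')\<^sup>2 / s = 2 * (s * (?E r')\<^sup>2)" using s by (simp add: power2_eq_square)
    ultimately show ?thesis using O unfolding tr by simp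
  qed
  ultimately show ?thesis
    unfolding G1 G2 G3 using J by (simp add: distrib_left)
qed

section \<open>Averaging out one coordinate\<close>

definition upd :: "real^'n \<Rightarrow> 'n \<Rightarrow> real \<Rightarrow> real^'n" where
  "upd x k t = (\<chi> i. if i = k then t else x $ i)"

lemma upd_nth [simp]: "upd x k t $ i = (if i = k then t else x $ i)"
  by (simp add: upd_def)

lemma upd_self [simp]: "upd x k (x $ k) = x"
  by (simp add: vec_eq_iff)

lemma upd_upd [simp]: "upd (upd x k t) k r = upd x k r"
  by (simp add: vec_eq_iff)

lemma upd_commute: "i \<noteq> k \<Longrightarrow> upd (upd x i t) k r = upd (upd x k r) i t"
  by (simp add: vec_eq_iff)

lemma upd_eq_axis: "upd x k t = x + (t - x $ k) *\<^sub>R axis k 1"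
  by (simp add: vec_eq_iff axis_def)

lemma continuous_on_upd [continuous_intros]:
  assumes "continuous_on S f" "continuous_on S g"
  shows "continuous_on S (\<lambda>z. upd (f z) k (g z))"
  unfolding upd_eq_axis using assms by (intro continuous_intros)

lemma tendsto_upd [tendsto_intros]:
  assumes "(f \<longlongrightarrow> x) F" "(g \<longlongrightarrow> t) F"
  shows "((\<lambda>z. upd (f z) k (g z)) \<longlongrightarrow> upd x k t) F"
  unfolding upd_eq_axis using assms by (intro tendsto_intros)

lemma borel_measurable_upd [measurable]:
  "(\<lambda>(x, t). upd x k t) \<in> borel \<Otimes>\<^sub>M borel \<rightarrow>\<^sub>M (borel :: (real^'n) measure)"
proof -
  have "continuous_on UNIV (\<lambda>z. upd (fst z) k (snd z) :: real^'n)"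
    by (intro continuous_intros)
  then show ?thesis
    by (simp add: borel_prod case_prod_beta borel_measurable_continuous_onI)
qed

lemma bcont_section:
  assumes "bcont f" shows "bcont (\<lambda>t. f (upd x k t))"
  by (rule bcont_compose[OF assms]) (intro continuous_intros)

lemma nth_measurable [measurable]: "(\<lambda>x. x $ i) \<in> borel_measurable (borel :: (real^'n) measure)"
  by (intro borel_measurable_continuous_onI continuous_intros)

text \<open>Derivatives are taken along coordinate lines only. This form is inherited by averages
  over one coordinate and is what the one-dimensional inequalities consume.\<close>

definition C1b :: "(real^'n \<Rightarrow> real) \<Rightarrow> ('n \<Rightarrow> real^'n \<Rightarrow> real) \<Rightarrow> bool" where
  "C1b f D \<longleftrightarrow> bcont f \<and> (\<forall>i. bcont (D i)) \<and>
     (\<forall>i x. ((\<lambda>t. f (upd x i t)) has_real_derivative D i x) (at (x $ i)))"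

lemma C1b_section:
  assumes "C1b f D"
  shows "C1b_real (\<lambda>t. f (upd x i t)) (\<lambda>t. D i (upd x i t))"
  unfolding C1b_real_def
proof (intro conjI allI)
  show "bcont (\<lambda>t. f (upd x i t))" "bcont (\<lambda>t. D i (upd x i t))"
    using assms unfolding C1b_def by (simp_all add: bcont_section)
  fix t
  have "((\<lambda>r. f (upd (upd x i t) i r)) has_real_derivative D i (upd x i t)) (at (upd x i t $ i))"
    using assms unfolding C1b_def by blast
  then show "((\<lambda>t. f (upd x i t)) has_real_derivative D i (upd x i t)) (at t)" by simp
qed

lemma eq_if_upd_invariant:
  fixes f :: "real^'n \<Rightarrow> real"
  assumes "\<And>i x t. i \<in> A \<Longrightarrow> f (upd x i t) = f x" "finite A"
  shows "f (\<chi> i. if i \<in> A then y $ i else x $ i) = f x"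
  using assms(2,1)
proof (induction A rule: finite_induct)
  case (insert k A)
  have "(\<chi> i. if i \<in> insert k A then y $ i else x $ i)
      = upd (\<chi> i. if i \<in> A then y $ i else x $ i) k (y $ k)"
    by (simp add: vec_eq_iff)
  then show ?case using insert by simp
qed simp

text \<open>The product structure is encoded by \<open>resample\<close>: overwriting coordinate k by
  an independent draw from \<open>K k\<close> preserves M. All averages thus stay functions on the
  same space, and the induction on coordinates never changes type. \<open>G\<close> collects the
  Gaussian coordinates.\<close>

locale resampling =
  fixes M :: "(real^'n) measure" and K :: "'n \<Rightarrow> real measure" and G :: "'n set" and s :: real
  assumes prob_M: "prob_space M" and sets_M: "sets M = sets borel"
    and prob_K: "prob_space (K k)" and sets_K: "sets (K k) = sets borel"
    and resample: "distr (M \<Otimes>\<^sub>M K k) borel (\<lambda>(x, t). upd x k t) = M"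
    and s_pos: "s > 0"
    and K_square: "integrable (K k) (\<lambda>t. t\<^sup>2)"
    and K_mean: "k \<in> G \<Longrightarrow> (\<integral>t. t \<partial>K k) = 0"
    and K_var: "k \<in> G \<Longrightarrow> (\<integral>t. t\<^sup>2 \<partial>K k) = s"
    and K_parts: "k \<in> G \<Longrightarrow> C1b_real h h' \<Longrightarrow> (\<integral>t. t * h t \<partial>K k) = s * (\<integral>t. h' t \<partial>K k)"
    and K_poincare: "C1b_real h h' \<Longrightarrow> 2 * ((\<integral>t. (h t)\<^sup>2 \<partial>K k) - (\<integral>t. h t \<partial>K k)\<^sup>2)
        \<le> s * ((\<integral>t. (h' t)\<^sup>2 \<partial>K k) + (if k \<in> G then (\<integral>t. h' t \<partial>K k)\<^sup>2 else 0))"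
begin

sublocale M: prob_space M by (rule prob_M)

declare sets_M [measurable_cong] sets_K [measurable_cong]

lemma K_finite: "finite_measure (K k)"
  using prob_K prob_space.finite_measure by blast

lemma pair_M_K: "pair_sigma_finite M (K k)"
  using prob_M prob_K by (auto simp: pair_sigma_finite_def prob_space_imp_sigma_finite)

lemma K_id: "integrable (K k) (\<lambda>t. t)"
  using finite_measure.square_integrable_imp_integrable[OF K_finite _ K_square] sets_K by simp

lemma integral_resample:
  fixes F :: "real^'n \<Rightarrow> real"
  assumes "integrable M F"
  shows "integral\<^sup>L M F = (\<integral>x. (\<integral>t. F (upd x k t) \<partial>K k) \<partial>M)"
proof -
  interpret P: pair_sigma_finite M "K k" by (rule pair_M_K)
  have [measurable]: "F \<in> borel_measurable borel" using assms sets_M by (auto cong: measurable_cong_sets)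
  have u: "(\<lambda>(x, t). upd x k t) \<in> M \<Otimes>\<^sub>M K k \<rightarrow>\<^sub>M borel" by measurable
  have "integrable (distr (M \<Otimes>\<^sub>M K k) borel (\<lambda>(x, t). upd x k t)) F"
    using assms by (simp add: resample)
  then have i: "integrable (M \<Otimes>\<^sub>M K k) (\<lambda>(x, t). F (upd x k t))"
    by (subst (asm) integrable_distr_eq[OF u]) (simp_all add: case_prod_beta')
  have "integral\<^sup>L M F = integral\<^sup>L (distr (M \<Otimes>\<^sub>M K k) borel (\<lambda>(x, t). upd x k t)) F"
    by (simp add: resample)
  also have "\<dots> = (\<integral>z. (\<lambda>(x, t). F (upd x k t)) z \<partial>(M \<Otimes>\<^sub>M K k))"
    by (subst integral_distr[OF u]) (simp_all add: case_prod_beta')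
  also have "\<dots> = (\<integral>x. (\<integral>t. F (upd x k t) \<partial>K k) \<partial>M)"
    using P.integral_fst[OF i] by simp
  finally show "integral\<^sup>L M F = (\<integral>x. (\<integral>t. F (upd x k t) \<partial>K k) \<partial>M)" .
qed

lemma bcont_integrable_M: "bcont f \<Longrightarrow> integrable M f"
  using bcont_integrable[OF _ sets_M M.finite_measure_axioms] .

lemma bcont_integrable_K: "bcont f \<Longrightarrow> integrable (K k) f"
  using bcont_integrable[OF _ sets_K K_finite] .

text \<open>With p = 1 this is the conditional expectation given the other coordinates; with p(t) =
  t/s and k in \<open>G\<close> it is the coefficient of x_k in the Hermite expansion of f in that
  variable.\<close>

definition avg :: "'n \<Rightarrow> (real \<Rightarrow> real) \<Rightarrow> (real^'n \<Rightarrow> real) \<Rightarrow> real^'n \<Rightarrow> real" where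
  "avg k p f x = (\<integral>t. p t * f (upd x k t) \<partial>K k)"

lemma avg_upd [simp]: "avg k p f (upd x k t) = avg k p f x"
  by (simp add: avg_def)

text \<open>Dominated convergence with the bound B |p|. The weight p is only assumed integrable so
  that the unbounded p(t) = t/s is covered.\<close>

lemma bcont_avg:
  assumes "integrable (K k) p" "bcont f"
  shows "bcont (avg k p f)"
proof -
  obtain B where cont: "continuous_on UNIV f" and B: "\<And>x. \<bar>f x\<bar> \<le> B"
    using assms(2) by (metis bcontE)
  have [measurable]: "p \<in> borel_measurable (K k)" using assms(1) by auto
  have m: "(\<lambda>t. f (upd x k t)) \<in> borel_measurable (K k)" for x
    by (rule bcont_measurable[OF bcont_section[OF assms(2)] sets_K])
  have int: "integrable (K k) (\<lambda>t. B * \<bar>p t\<bar>)" using assms(1) by auto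
  have bnd: "norm (p t * f y) \<le> B * \<bar>p t\<bar>" for t y
    using mult_left_mono[OF B[of y], of "\<bar>p t\<bar>"] by (simp add: abs_mult mult.commute)
  have "continuous_on UNIV (avg k p f)"
    unfolding continuous_on_sequentially
  proof (intro allI ballI impI)
    fix X x assume "(\<forall>n. X n \<in> UNIV) \<and> X \<longlonglongrightarrow> (x :: real^'n)"
    then have X: "X \<longlonglongrightarrow> x" by simp
    have "(\<lambda>n. p t * f (upd (X n) k t)) \<longlonglongrightarrow> p t * f (upd x k t)" for t
      by (intro tendsto_intros continuous_on_tendsto_compose[OF cont] X) auto
    then show "(avg k p f \<circ> X) \<longlonglongrightarrow> avg k p f x"
      unfolding avg_def o_def using m bnd
      by (intro integral_dominated_convergence[OF _ _ int]) auto
  qed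
  moreover have "\<bar>avg k p f x\<bar> \<le> (\<integral>t. B * \<bar>p t\<bar> \<partial>K k)" for x
    using Bochner_Integration.integral_norm_bound_integral[OF bcont_integrable_mult[OF bcont_section[OF assms(2)] sets_K assms(1)] int bnd]
    unfolding avg_def by simp
  ultimately show ?thesis unfolding bcont_iff by blast
qed

text \<open>Differentiation under the integral sign: by the mean value inequality the difference
  quotients are bounded by a bound of D i, hence B |p| dominates. In direction k the average is
  constant.\<close>

lemma C1b_avg:
  assumes p: "integrable (K k) p" and f: "C1b f D"
  shows "C1b (avg k p f) (\<lambda>i. if i = k then (\<lambda>x. 0) else avg k p (D i))"
  unfolding C1b_def
proof (intro conjI allI)
  have bf: "bcont f" and bD: "\<And>i. bcont (D i)" using f unfolding C1b_def by auto
  show "bcont (avg k p f)" by (rule bcont_avg[OF p bf])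
  show "bcont (if i = k then (\<lambda>x. 0) else avg k p (D i))" for i
    using bcont_avg[OF p bD] by simp
  fix i x
  show "((\<lambda>t. avg k p f (upd x i t)) has_real_derivative
      (if i = k then (\<lambda>x. 0) else avg k p (D i)) x) (at (x $ i))"
  proof (cases "i = k")
    case False
    obtain B where B: "\<And>x. \<bar>D i x\<bar> \<le> B" using bD[of i] by (metis bcontE)
    have [measurable]: "p \<in> borel_measurable (K k)" using p by auto
    have m: "(\<lambda>t. g (upd y k t)) \<in> borel_measurable (K k)" if "bcont g" for g y
      by (rule bcont_measurable[OF bcont_section[OF that] sets_K])
    have int: "integrable (K k) (\<lambda>t. B * \<bar>p t\<bar>)" using p by auto
    have ints: "integrable (K k) (\<lambda>t. p t * f (upd y k t))" for y
      by (rule bcont_integrable_mult[OF bcont_section[OF bf] sets_K p])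
    have der: "((\<lambda>r. f (upd (upd x k t) i r)) has_real_derivative D i (upd (upd x k t) i r)) (at r)"
      for t r using C1b_section[OF f, of "upd x k t" i] unfolding C1b_real_def by blast
    define Q where "Q t h = (f (upd (upd x i (x $ i + h)) k t) - f (upd x k t)) / h" for t h
    have lim: "((\<lambda>h. Q t h) \<longlongrightarrow> D i (upd x k t)) (at 0)" for t
    proof -
      have "upd (upd x k t) i (x $ i) = upd x k t" using False by (simp add: vec_eq_iff)
      then show ?thesis
        using der[of t "x $ i"] False unfolding DERIV_def Q_def by (simp add: upd_commute[of i k])
    qed
    have Qb: "\<bar>Q t h\<bar> \<le> B" if "h \<noteq> 0" for t h
    proof -
      have "norm (f (upd (upd x k t) i (x $ i + h)) - f (upd (upd x k t) i (x $ i))) \<le> B * norm (x $ i + h - x $ i)"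
        by (rule field_differentiable_bound[OF convex_UNIV]) (use der B in auto)
      moreover have "upd (upd x k t) i (x $ i) = upd x k t" using False by (simp add: vec_eq_iff)
      ultimately show ?thesis
        using that False unfolding Q_def by (simp add: upd_commute[of i k] field_simps)
    qed
    have "(\<lambda>h. (avg k p f (upd x i (x $ i + h)) - avg k p f (upd x i (x $ i))) / h)
        = (\<lambda>h. \<integral>t. p t * Q t h \<partial>K k)"
    proof
      fix h
      show "(avg k p f (upd x i (x $ i + h)) - avg k p f (upd x i (x $ i))) / h = (\<integral>t. p t * Q t h \<partial>K k)"
        unfolding avg_def Q_def upd_self
        by (subst Bochner_Integration.integral_diff[symmetric, OF ints ints])
           (simp add: right_diff_distrib)
    qed
    moreover have "((\<lambda>h. \<integral>t. p t * Q t h \<partial>K k) \<longlongrightarrow> avg k p (D i) x) (at 0)"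
      unfolding tendsto_at_iff_sequentially o_def
    proof (intro allI impI)
      fix X :: "nat \<Rightarrow> real" assume X: "\<forall>n. X n \<in> UNIV - {0}" "X \<longlonglongrightarrow> 0"
      have "(\<lambda>n. Q t (X n)) \<longlonglongrightarrow> D i (upd x k t)" for t
        using lim[of t] X unfolding tendsto_at_iff_sequentially o_def by blast
      then have "(\<lambda>n. p t * Q t (X n)) \<longlonglongrightarrow> p t * D i (upd x k t)" for t
        by (intro tendsto_intros)
      moreover have "norm (p t * Q t (X n)) \<le> B * \<bar>p t\<bar>" for t n
        using mult_left_mono[OF Qb[of "X n" t], of "\<bar>p t\<bar>"] X by (simp add: abs_mult mult.commute)
      moreover have "(\<lambda>t. p t * Q t (X n)) \<in> borel_measurable (K k)" for n
        unfolding Q_def using m[OF bf] by measurable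
      moreover have "(\<lambda>t. p t * D i (upd x k t)) \<in> borel_measurable (K k)"
        using m[OF bD] by measurable
      ultimately show "(\<lambda>n. \<integral>t. p t * Q t (X n) \<partial>K k) \<longlonglongrightarrow> avg k p (D i) x"
        unfolding avg_def by (intro integral_dominated_convergence[OF _ _ int]) auto
    qed
    ultimately show ?thesis using False unfolding DERIV_def by simp
  qed simp
qed

end

section \<open>Tensorization of the second-order inequality\<close>

context resampling
begin

lemma K_one: "integrable (K k) (\<lambda>t. 1 :: real)"
  using bcont_integrable_K[OF bcont_const] .

lemma avg_square_le:
  assumes "bcont f"
  shows "(avg k (\<lambda>t. 1) f x)\<^sup>2 \<le> avg k (\<lambda>t. 1) (\<lambda>y. (f y)\<^sup>2) x"
proof -
  interpret K: prob_space "K k" by (rule prob_K)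
  show ?thesis
    unfolding avg_def
    using K.square_integral_le[of "\<lambda>t. f (upd x k t)"] bcont_section[OF assms]
      bcont_section[OF bcont_power2[OF assms]] by (simp add: bcont_integrable_K)
qed

text \<open>Bessel's inequality in the variable x_k: the functions 1 and t are orthogonal in
  L^2(\<open>K k\<close>) with E t^2 = s, so the residual of the projection a + (b/s) t has square
  norm c - a^2 - b^2/s >= 0.\<close>

lemma avg_id_square_le:
  assumes "k \<in> G" "bcont f"
  shows "(avg k (\<lambda>t. t / s) f x)\<^sup>2
    \<le> (avg k (\<lambda>t. 1) (\<lambda>y. (f y)\<^sup>2) x - (avg k (\<lambda>t. 1) f x)\<^sup>2) / s"
proof -
  interpret K: prob_space "K k" by (rule prob_K)
  let ?g = "\<lambda>t. f (upd x k t)"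
  define a where "a = (\<integral>t. ?g t \<partial>K k)"
  define b where "b = (\<integral>t. t * ?g t \<partial>K k)"
  define c where "c = (\<integral>t. (?g t)\<^sup>2 \<partial>K k)"
  have g: "bcont ?g" and g2: "bcont (\<lambda>t. (?g t)\<^sup>2)"
    using bcont_section[OF assms(2)] bcont_section[OF bcont_power2[OF assms(2)]] by auto
  note i = bcont_integrable_K[OF g] bcont_integrable_K[OF g2] K_id K_square
    bcont_integrable_mult[OF g sets_K K_id]
  have "0 \<le> (\<integral>t. (?g t - a - b / s * t)\<^sup>2 \<partial>K k)" by simp
  also have "\<dots> = (\<integral>t. (?g t)\<^sup>2 + a\<^sup>2 + (b / s)\<^sup>2 * t\<^sup>2 - 2 * a * ?g t
      - 2 * (b / s) * (t * ?g t) + 2 * a * (b / s) * t \<partial>K k)"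
    by (simp add: power2_eq_square algebra_simps)
  also have "\<dots> = c + a\<^sup>2 + (b / s)\<^sup>2 * s - 2 * a * a - 2 * (b / s) * b + 2 * a * (b / s) * 0"
    using i K_mean[OF assms(1)] K_var[OF assms(1)]
    by (simp add: K.prob_space a_def b_def c_def)
  also have "\<dots> = c - a\<^sup>2 - b\<^sup>2 / s"
    using s_pos by (simp add: field_simps power2_eq_square)
  finally have "b\<^sup>2 / s \<le> c - a\<^sup>2" by simp
  then have "b\<^sup>2 / s / s \<le> (c - a\<^sup>2) / s"
    using s_pos by (intro divide_right_mono) auto
  moreover have "avg k (\<lambda>t. t / s) f x = b / s"
    unfolding avg_def b_def by simp
  moreover have "avg k (\<lambda>t. 1) f x = a" "avg k (\<lambda>t. 1) (\<lambda>y. (f y)\<^sup>2) x = c"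
    unfolding avg_def a_def c_def by simp_all
  ultimately show ?thesis
    by (simp add: power_divide power2_eq_square)
qed

text \<open>When a coordinate k in G is averaged out, the one-dimensional inequality leaves the term
  E (avg_k (D k f))^2 in place of (E (D k f))^2. The difference is the variance of
  avg_k (D k f) = avg_k (x_k f) / s, which is controlled by the first-order case of the induction
  hypothesis and by Cauchy-Schwarz in the variable x_k.\<close>

lemma second_order_poincare_aux:
  assumes "finite J" "C1b f D" "\<And>i x t. i \<notin> J \<Longrightarrow> f (upd x i t) = f x"
  shows "2 * ((\<integral>x. (f x)\<^sup>2 \<partial>M) - (\<integral>x. f x \<partial>M)\<^sup>2)
    \<le> s * ((\<Sum>i\<in>UNIV. \<integral>x. (D i x)\<^sup>2 \<partial>M) + (\<Sum>i\<in>G. (\<integral>x. D i x \<partial>M)\<^sup>2))"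
  using assms
\<comment> \<open>\<open>J\<close> contains the coordinates on which f may depend. Generality in f
  and D matters because the hypothesis is applied both to \<open>?A f\<close> and to
  \<open>?H f\<close>.\<close>
proof (induction J arbitrary: f D rule: finite_induct)
  case empty
  have "f x = f 0" for x
    using eq_if_upd_invariant[of UNIV f x 0] empty(2) by simp
  then obtain c where "f = (\<lambda>x. c)" by blast
  then have "(\<integral>x. (f x)\<^sup>2 \<partial>M) - (\<integral>x. f x \<partial>M)\<^sup>2 = 0"
    by (simp add: M.prob_space)
  then show ?case
    using s_pos by (simp add: sum_nonneg)
next
  case (insert k J)
  let ?E = "\<lambda>f. \<integral>x. f x \<partial>M"
  let ?A = "avg k (\<lambda>t. 1)"
  let ?H = "avg k (\<lambda>t. t / s)"
  have f: "bcont f" and D: "\<And>i. bcont (D i)" using insert.prems(1) unfolding C1b_def by auto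
  have ps: "integrable (K k) (\<lambda>t. t / s)" using K_id by simp
  have E_avg: "?E (?A h) = ?E h" if "bcont h" for h
    using integral_resample[OF bcont_integrable_M[OF that], of k] unfolding avg_def by simp
  have int: "integrable M (?A h)" "integrable M (\<lambda>x. (?A h x)\<^sup>2)" "integrable M (\<lambda>x. (?H h x)\<^sup>2)"
    if "bcont h" for h
    using that by (auto intro!: bcont_integrable_M bcont_power2 bcont_avg K_one ps)
  have inv: "avg k p f (upd x i t) = avg k p f x" if "i \<notin> J" for p i x t
  proof (cases "i = k")
    case False
    then have "f (upd (upd x i t) k r) = f (upd x k r)" for r
      using insert.prems(2)[of i] that by (simp add: upd_commute[of i k])
    then show ?thesis by (simp add: avg_def)
  qed simp
  have E_jensen: "?E (\<lambda>x. (?A (D i) x)\<^sup>2) \<le> ?E (\<lambda>x. (D i x)\<^sup>2)" for i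
  proof -
    have "?E (\<lambda>x. (?A (D i) x)\<^sup>2) \<le> ?E (?A (\<lambda>x. (D i x)\<^sup>2))"
      by (intro integral_mono int D bcont_power2 avg_square_le)
    then show ?thesis by (simp add: E_avg D bcont_power2)
  qed
  have split: "(\<Sum>i\<in>UNIV. h i) = h k + (\<Sum>i\<in>UNIV-{k}. h i)" for h :: "'n \<Rightarrow> real"
    by (simp add: sum.remove)
  have splitG: "(\<Sum>i\<in>G. h i) = (if k \<in> G then h k else 0) + (\<Sum>i\<in>G-{k}. h i)" for h :: "'n \<Rightarrow> real"
    by (simp add: sum.remove)

  \<comment> \<open>Law of total variance: fact 1 bounds the variance of the conditional mean by the
    induction hypothesis, fact 2 the mean of the conditional variance by the one-dimensional
    inequality.\<close>
  have "2 * (?E (\<lambda>x. (?A f x)\<^sup>2) - (?E (?A f))\<^sup>2)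
      \<le> s * ((\<Sum>i\<in>UNIV. ?E (\<lambda>x. ((if i = k then (\<lambda>x. 0) else ?A (D i)) x)\<^sup>2))
        + (\<Sum>i\<in>G. (?E (if i = k then (\<lambda>x. 0) else ?A (D i)))\<^sup>2))"
    by (rule insert.IH[OF C1b_avg[OF K_one insert.prems(1)] inv])
  also have "\<dots> = s * ((\<Sum>i\<in>UNIV-{k}. ?E (\<lambda>x. (?A (D i) x)\<^sup>2)) + (\<Sum>i\<in>G-{k}. (?E (D i))\<^sup>2))"
    by (simp add: split splitG E_avg D)
  finally have 1: "2 * (?E (\<lambda>x. (?A f x)\<^sup>2) - (?E f)\<^sup>2)
      \<le> s * ((\<Sum>i\<in>UNIV-{k}. ?E (\<lambda>x. (?A (D i) x)\<^sup>2)) + (\<Sum>i\<in>G-{k}. (?E (D i))\<^sup>2))"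
    by (simp add: E_avg f)

  have pt: "2 * (?A (\<lambda>x. (f x)\<^sup>2) x - (?A f x)\<^sup>2)
      \<le> s * (?A (\<lambda>x. (D k x)\<^sup>2) x + (if k \<in> G then (?A (D k) x)\<^sup>2 else 0))" for x
    using K_poincare[OF C1b_section[OF insert.prems(1), of x k], of k] unfolding avg_def by (simp split: if_splits)
  have int_if: "integrable M (\<lambda>x. if k \<in> G then (?A (D k) x)\<^sup>2 else 0)"
    using int(2)[OF D[of k]] by (cases "k \<in> G") auto
  have "?E (\<lambda>x. 2 * (?A (\<lambda>x. (f x)\<^sup>2) x - (?A f x)\<^sup>2))
      \<le> ?E (\<lambda>x. s * (?A (\<lambda>x. (D k x)\<^sup>2) x + (if k \<in> G then (?A (D k) x)\<^sup>2 else 0)))"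
    using int_if int[OF f] int[OF D[of k]] int(1)[OF bcont_power2[OF f]] int(1)[OF bcont_power2[OF D[of k]]]
    by (intro integral_mono pt) auto
  then have 2: "2 * (?E (\<lambda>x. (f x)\<^sup>2) - ?E (\<lambda>x. (?A f x)\<^sup>2))
      \<le> s * (?E (\<lambda>x. (D k x)\<^sup>2) + (if k \<in> G then ?E (\<lambda>x. (?A (D k) x)\<^sup>2) else 0))"
    using int_if int[OF f] int[OF D[of k]] int(1)[OF bcont_power2[OF f]] int(1)[OF bcont_power2[OF D[of k]]]
    by (cases "k \<in> G") (simp_all add: E_avg f D bcont_power2)

  \<comment> \<open>The sum of 1 and 2 exceeds the claim in the k-th correction term and falls short
    of it in the averaged derivatives; this compares the two discrepancies.\<close>
  have "(if k \<in> G then ?E (\<lambda>x. (?A (D k) x)\<^sup>2) else 0) + (\<Sum>i\<in>UNIV-{k}. ?E (\<lambda>x. (?A (D i) x)\<^sup>2))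
      \<le> (if k \<in> G then (?E (D k))\<^sup>2 else 0) + (\<Sum>i\<in>UNIV-{k}. ?E (\<lambda>x. (D i x)\<^sup>2))"
  proof (cases "k \<in> G")
    case False
    then show ?thesis using sum_mono[of "UNIV-{k}", OF E_jensen] by simp
  next
    case True
    have HA: "?H f = ?A (D k)"
      using K_parts[OF True C1b_section[OF insert.prems(1)]] s_pos
      unfolding avg_def by (simp add: fun_eq_iff)
    let ?H' = "\<lambda>i. if i = k then (\<lambda>x. 0) else ?H (D i)"
    have H': "bcont (?H' i)" for i using bcont_avg[OF ps D] by simp
    have "2 * (?E (\<lambda>x. (?H f x)\<^sup>2) - (?E (?H f))\<^sup>2)
        \<le> s * ((\<Sum>i\<in>UNIV. ?E (\<lambda>x. (?H' i x)\<^sup>2)) + (\<Sum>i\<in>G. (?E (?H' i))\<^sup>2))"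
      by (rule insert.IH[OF C1b_avg[OF ps insert.prems(1)] inv])
    \<comment> \<open>Squared means are at most mean squares, so the hypothesis weakens to the
      ordinary Poincare inequality with constant s, enough for the variance of
      \<open>?H f\<close>.\<close>
    also have "\<dots> \<le> s * ((\<Sum>i\<in>UNIV. ?E (\<lambda>x. (?H' i x)\<^sup>2)) + (\<Sum>i\<in>UNIV. ?E (\<lambda>x. (?H' i x)\<^sup>2)))"
    proof (intro mult_left_mono add_left_mono)
      have "(\<Sum>i\<in>G. (?E (?H' i))\<^sup>2) \<le> (\<Sum>i\<in>G. ?E (\<lambda>x. (?H' i x)\<^sup>2))"
        by (intro sum_mono M.square_integral_le bcont_integrable_M bcont_power2 H')
      also have "\<dots> \<le> (\<Sum>i\<in>UNIV. ?E (\<lambda>x. (?H' i x)\<^sup>2))"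
        by (intro sum_mono2) auto
      finally show "(\<Sum>i\<in>G. (?E (?H' i))\<^sup>2) \<le> (\<Sum>i\<in>UNIV. ?E (\<lambda>x. (?H' i x)\<^sup>2))" .
    qed (use s_pos in simp)
    finally have "?E (\<lambda>x. (?H f x)\<^sup>2) - (?E (?H f))\<^sup>2 \<le> s * (\<Sum>i\<in>UNIV. ?E (\<lambda>x. (?H' i x)\<^sup>2))"
      by simp
    also have "\<dots> = (\<Sum>i\<in>UNIV-{k}. s * ?E (\<lambda>x. (?H (D i) x)\<^sup>2))"
      by (simp add: split sum_distrib_left)
    \<comment> \<open>Each term is covered by what Jensen discards in direction i: by Bessel, the
      first Hermite coefficient of D i in x_k costs at most its conditional variance.\<close>
    also have "\<dots> \<le> (\<Sum>i\<in>UNIV-{k}. ?E (\<lambda>x. (D i x)\<^sup>2) - ?E (\<lambda>x. (?A (D i) x)\<^sup>2))"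
    proof (intro sum_mono)
      fix i
      have "?E (\<lambda>x. (?H (D i) x)\<^sup>2) \<le> ?E (\<lambda>x. (?A (\<lambda>y. (D i y)\<^sup>2) x - (?A (D i) x)\<^sup>2) / s)"
        using int[OF D[of i]] int(1)[OF bcont_power2[OF D[of i]]]
        by (intro integral_mono avg_id_square_le True D) auto
      also have "\<dots> = (?E (\<lambda>x. (D i x)\<^sup>2) - ?E (\<lambda>x. (?A (D i) x)\<^sup>2)) / s"
        using int[OF D[of i]] int(1)[OF bcont_power2[OF D[of i]]]
        by (simp add: E_avg D bcont_power2)
      finally show "s * ?E (\<lambda>x. (?H (D i) x)\<^sup>2) \<le> ?E (\<lambda>x. (D i x)\<^sup>2) - ?E (\<lambda>x. (?A (D i) x)\<^sup>2)"
        using s_pos by (simp add: field_simps)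
    qed
    finally show ?thesis
      using True by (simp add: HA E_avg D sum_subtractf)
  qed
  then have "s * ((if k \<in> G then ?E (\<lambda>x. (?A (D k) x)\<^sup>2) else 0) + (\<Sum>i\<in>UNIV-{k}. ?E (\<lambda>x. (?A (D i) x)\<^sup>2)))
      \<le> s * ((if k \<in> G then (?E (D k))\<^sup>2 else 0) + (\<Sum>i\<in>UNIV-{k}. ?E (\<lambda>x. (D i x)\<^sup>2)))"
    using s_pos by (intro mult_left_mono) auto
  with 1 2 show ?case
    unfolding split splitG by (simp add: distrib_left)
qed

lemmas second_order_poincare = second_order_poincare_aux[OF finite, of _ _ UNIV, simplified]

section \<open>Moments of the coordinates and the best affine function\<close>

text \<open>Under M the k-th coordinate has law \<open>K k\<close>, because after resampling it is
  the fresh draw itself.\<close>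

lemma integrable_coordinate:
  assumes "integrable (K k) q"
  shows "integrable M (\<lambda>x. q (x $ k) :: real)"
proof -
  interpret P: pair_sigma_finite M "K k" by (rule pair_M_K)
  have q: "q \<in> borel_measurable borel" using assms sets_K[of k] by (auto cong: measurable_cong_sets)
  note [measurable] = q
  have u: "(\<lambda>(x, t). upd x k t) \<in> M \<Otimes>\<^sub>M K k \<rightarrow>\<^sub>M borel" by measurable
  have "integrable (M \<Otimes>\<^sub>M K k) (\<lambda>z. q (snd z))"
    by (rule P.Fubini_integrable) (use assms in auto)
  then have "integrable (distr (M \<Otimes>\<^sub>M K k) borel (\<lambda>(x, t). upd x k t)) (\<lambda>x. q (x $ k))"
    by (subst integrable_distr_eq[OF u]) (simp_all add: case_prod_beta')
  then show ?thesis by (simp add: resample)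
qed

lemma integrable_coordinates:
  "integrable M (\<lambda>x. x $ i)" "integrable M (\<lambda>x. (x $ i)\<^sup>2)" "integrable M (\<lambda>x. x $ i * x $ j)"
proof -
  show "integrable M (\<lambda>x. x $ i)" using integrable_coordinate[OF K_id] .
  have sq: "integrable M (\<lambda>x. (x $ i)\<^sup>2)" for i using integrable_coordinate[OF K_square] .
  show "integrable M (\<lambda>x. (x $ i)\<^sup>2)" by (rule sq)
  have "integrable M (\<lambda>x. (x $ i)\<^sup>2 + (x $ j)\<^sup>2)" using sq by auto
  then show "integrable M (\<lambda>x. x $ i * x $ j)"
  proof (rule Bochner_Integration.integrable_bound)
    have "\<bar>a * b\<bar> \<le> a\<^sup>2 + b\<^sup>2" for a b :: real
      using sum_squares_bound[of "\<bar>a\<bar>" "\<bar>b\<bar>"] mult_nonneg_nonneg[of "\<bar>a\<bar>" "\<bar>b\<bar>"]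
      unfolding abs_mult power2_abs by linarith
    then show "AE x in M. norm (x $ i * x $ j) \<le> norm ((x $ i)\<^sup>2 + (x $ j)\<^sup>2)" by simp
  qed measurable
qed

lemma integral_coordinate: "i \<in> G \<Longrightarrow> (\<integral>x. x $ i \<partial>M) = 0"
  using integral_resample[OF integrable_coordinates(1), of i i] by (simp add: K_mean)

text \<open>Resampling x_i alone suffices: for j different from i its mean zero kills the product,
  whatever the law of x_j.\<close>

lemma integral_coordinate_mult:
  assumes "i \<in> G" shows "(\<integral>x. x $ i * x $ j \<partial>M) = (if i = j then s else 0)"
proof -
  have "(\<integral>x. x $ i * x $ j \<partial>M) = (\<integral>x. \<integral>t. (upd x i t) $ i * (upd x i t) $ j \<partial>K i \<partial>M)"
    by (rule integral_resample[OF integrable_coordinates(3)])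
  also have "\<dots> = (if i = j then s else 0)"
    using K_var[OF assms] K_mean[OF assms] by (auto simp: M.prob_space power2_eq_square)
  finally show ?thesis .
qed

lemma integral_coordinate_parts:
  assumes "i \<in> G" "C1b f D"
  shows "(\<integral>x. x $ i * f x \<partial>M) = s * (\<integral>x. D i x \<partial>M)"
proof -
  have f: "bcont f" and D: "bcont (D i)" using assms(2) unfolding C1b_def by auto
  have "(\<integral>x. x $ i * f x \<partial>M) = (\<integral>x. \<integral>t. (upd x i t) $ i * f (upd x i t) \<partial>K i \<partial>M)"
    by (rule integral_resample[OF bcont_integrable_mult[OF f sets_M integrable_coordinates(1)]])
  also have "\<dots> = s * (\<integral>x. \<integral>t. D i (upd x i t) \<partial>K i \<partial>M)"
    using K_parts[OF assms(1) C1b_section[OF assms(2)]] by simp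
  finally show ?thesis
    using integral_resample[OF bcont_integrable_M[OF D], of i] by simp
qed

text \<open>The witness c + d \<bullet> x is the L^2 projection of f onto affine functions of the
  coordinates in \<open>G\<close>; integration by parts identifies its slope E (x_i f) / s with E (D
  i f). The vanishing of d off \<open>G\<close> is exported because it makes d orthogonal to the
  mean vector of the theorem.\<close>

lemma affine_approximation:
  assumes "C1b f D"
  obtains c :: real and d :: "real^'n" where "\<And>i. i \<notin> G \<Longrightarrow> d $ i = 0"
    "(\<integral>\<^sup>+x. ennreal ((f x - c)\<^sup>2 + 1 / 2 * (f x - c - d \<bullet> x)\<^sup>2) \<partial>M)
      \<le> ennreal s * (\<integral>\<^sup>+x. ennreal (\<Sum>i\<in>UNIV. (D i x)\<^sup>2) \<partial>M)"
proof -
  let ?E = "\<lambda>f. \<integral>x. f x \<partial>M"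
  define c where "c = ?E f"
  define d :: "real^'n" where "d = (\<chi> i. if i \<in> G then ?E (D i) else 0)"
  have f: "bcont f" and D: "\<And>i. bcont (D i)" using assms unfolding C1b_def by auto
  have dx: "d \<bullet> x = (\<Sum>i\<in>G. ?E (D i) * x $ i)" for x
    by (simp add: inner_vec_def d_def sum.If_cases if_distrib[where f="\<lambda>a. a * _"] cong: if_cong)
  define S where "S = (\<Sum>i\<in>G. (?E (D i))\<^sup>2)"
  define T where "T = (\<Sum>i\<in>UNIV. ?E (\<lambda>x. (D i x)\<^sup>2))"
  have i1: "integrable M (\<lambda>x. d \<bullet> x)"
    unfolding dx using integrable_coordinates by auto
  have i2: "integrable M (\<lambda>x. (d \<bullet> x) * f x)"
    by (rule bcont_integrable_mult[OF f sets_M i1])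
  have sq: "(d \<bullet> x)\<^sup>2 = (\<Sum>i\<in>G. \<Sum>j\<in>G. ?E (D i) * ?E (D j) * (x $ i * x $ j))" for x
    unfolding dx power2_eq_square sum_product by (intro sum.cong refl) (simp only: mult_ac)
  have i3: "integrable M (\<lambda>x. (d \<bullet> x)\<^sup>2)"
    unfolding sq using integrable_coordinates by auto
  have E1: "?E (\<lambda>x. d \<bullet> x) = 0"
    unfolding dx using integrable_coordinates by (subst Bochner_Integration.integral_sum) (auto simp: integral_coordinate)
  have E2: "?E (\<lambda>x. (d \<bullet> x) * f x) = s * S"
  proof -
    have "?E (\<lambda>x. (d \<bullet> x) * f x) = ?E (\<lambda>x. \<Sum>i\<in>G. ?E (D i) * (x $ i * f x))"
      unfolding dx by (simp add: sum_distrib_right mult.assoc)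
    also have "\<dots> = (\<Sum>i\<in>G. ?E (D i) * ?E (\<lambda>x. x $ i * f x))"
      by (subst Bochner_Integration.integral_sum)
         (auto intro!: bcont_integrable_mult[OF f sets_M integrable_coordinates(1)])
    also have "\<dots> = s * S"
      unfolding S_def sum_distrib_left power2_eq_square
      by (intro sum.cong refl) (simp add: integral_coordinate_parts[OF _ assms])
    finally show ?thesis .
  qed
  have E3: "?E (\<lambda>x. (d \<bullet> x)\<^sup>2) = s * S"
  proof -
    have "?E (\<lambda>x. (d \<bullet> x)\<^sup>2) = (\<Sum>i\<in>G. \<Sum>j\<in>G. ?E (D i) * ?E (D j) * ?E (\<lambda>x. x $ i * x $ j))"
      unfolding sq by (simp add: Bochner_Integration.integral_sum integrable_coordinates)
    also have "\<dots> = (\<Sum>i\<in>G. ?E (D i) * ?E (D i) * s)"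
      by (intro sum.cong refl) (simp add: integral_coordinate_mult if_distrib cong: if_cong)
    finally show ?thesis by (simp add: S_def sum_distrib_left power2_eq_square mult.commute)
  qed
  define V where "V = ?E (\<lambda>x. (f x)\<^sup>2) - c\<^sup>2"
  let ?Q = "\<lambda>x. (f x - c)\<^sup>2 + 1 / 2 * (f x - c - d \<bullet> x)\<^sup>2"
  have Q: "?Q x = 3 / 2 * (f x)\<^sup>2 + 3 / 2 * c\<^sup>2 - 3 * c * f x + 1 / 2 * (d \<bullet> x)\<^sup>2 + c * (d \<bullet> x) - (d \<bullet> x) * f x" for x
    by (simp add: power2_eq_square algebra_simps)
  note i = bcont_integrable_M[OF f] bcont_integrable_M[OF bcont_power2[OF f]] i1 i2 i3
  have iQ: "integrable M ?Q" unfolding Q using i by auto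
  have "?E ?Q = 3 / 2 * ?E (\<lambda>x. (f x)\<^sup>2) + 3 / 2 * c\<^sup>2 - 3 * c * c + 1 / 2 * (s * S) + c * 0 - s * S"
    unfolding Q using i by (simp add: E1 E2 E3 M.prob_space c_def[symmetric])
  also have "\<dots> = 3 / 2 * V - 1 / 2 * (s * S)"
    unfolding V_def by (simp add: field_simps power2_eq_square)
  \<comment> \<open>The first square contributes V, the second V - s S by Pythagoras, taken with
    factor 1/2.\<close>
  finally have EQ: "?E ?Q = 3 / 2 * V - 1 / 2 * (s * S)" .
  have "2 * V \<le> s * T + s * S"
    using second_order_poincare[OF assms] unfolding V_def T_def S_def c_def by (simp add: distrib_left)
  moreover have "s * S \<le> s * T"
  proof (intro mult_left_mono)
    have "S \<le> (\<Sum>i\<in>G. ?E (\<lambda>x. (D i x)\<^sup>2))"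
      unfolding S_def by (intro sum_mono M.square_integral_le bcont_integrable_M bcont_power2 D)
    also have "\<dots> \<le> T" unfolding T_def by (intro sum_mono2) auto
    finally show "S \<le> T" .
  qed (use s_pos in simp)
  ultimately have le: "?E ?Q \<le> s * T" unfolding EQ by simp
  have iD: "integrable M (\<lambda>x. \<Sum>i\<in>UNIV. (D i x)\<^sup>2)"
    by (intro Bochner_Integration.integrable_sum bcont_integrable_M bcont_power2 D)
  have "(\<integral>\<^sup>+x. ennreal (?Q x) \<partial>M) = ennreal (?E ?Q)"
    by (rule nn_integral_eq_integral[OF iQ]) simp
  also have "\<dots> \<le> ennreal (s * T)" using le by (rule ennreal_leI)
  also have "T = ?E (\<lambda>x. \<Sum>i\<in>UNIV. (D i x)\<^sup>2)"
    unfolding T_def by (intro Bochner_Integration.integral_sum[symmetric] bcont_integrable_M bcont_power2 D)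
  also have "ennreal (s * \<dots>) = ennreal s * (\<integral>\<^sup>+x. ennreal (\<Sum>i\<in>UNIV. (D i x)\<^sup>2) \<partial>M)"
    using s_pos by (subst nn_integral_eq_integral[OF iD]) (auto simp: ennreal_mult' sum_nonneg)
  finally show thesis
    by (intro that[of d c]) (simp_all add: d_def)
qed

end

section \<open>The product structure of the measure\<close>

definition factor_density :: "real^'n \<Rightarrow> real \<Rightarrow> 'n \<Rightarrow> real \<Rightarrow> real" where
  "factor_density \<alpha> s i t = (if \<alpha> $ i = 0 then exp (- t\<^sup>2 / (2 * s)) / (2 * half_mass s 0)
     else indicator {0<..} t * half_weight s (\<alpha> $ i) t / half_mass s (\<alpha> $ i))"

definition factor_mass :: "real^'n \<Rightarrow> real \<Rightarrow> 'n \<Rightarrow> real" where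
  "factor_mass \<alpha> s i = (if \<alpha> $ i = 0 then 2 * half_mass s 0 else half_mass s (\<alpha> $ i))"

definition factor :: "real^'n \<Rightarrow> real \<Rightarrow> 'n \<Rightarrow> real measure" where
  "factor \<alpha> s i = (if \<alpha> $ i = 0 then gauss s else half_measure s (\<alpha> $ i))"

lemma factor_density_measurable [measurable]: "factor_density \<alpha> s i \<in> borel_measurable borel"
  unfolding factor_density_def by measurable

lemma factor_eq_density: "factor \<alpha> s i = density lborel (\<lambda>t. ennreal (factor_density \<alpha> s i t))"
  by (simp add: factor_def factor_density_def gauss_def half_measure_def)

lemma sets_factor [simp, measurable_cong]: "sets (factor \<alpha> s i) = sets borel"
  by (simp add: factor_def)

lemma factor_mass_pos:
  assumes "s > 0" "\<alpha> $ i \<ge> 0" shows "factor_mass \<alpha> s i > 0"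
  using assms half_mass_pos[of s] by (simp add: factor_mass_def)

lemma factor_density_nonneg:
  assumes "s > 0" "\<alpha> $ i \<ge> 0" shows "factor_density \<alpha> s i t \<ge> 0"
  using assms half_mass_pos[of s 0] half_mass_pos[of s "\<alpha> $ i"] by (simp add: factor_density_def)

lemma prob_space_factor:
  assumes "s > 0" "\<alpha> $ i \<ge> 0" shows "prob_space (factor \<alpha> s i)"
  using assms by (simp add: factor_def prob_space_gauss prob_space_half_measure)

lemma vec_lambda_measurable [measurable]:
  assumes "\<And>i. sets (M i) = sets borel"
  shows "(\<lambda>x. \<chi> i. x i) \<in> PiM UNIV M \<rightarrow>\<^sub>M (borel :: (real^'n) measure)"
proof (rule borel_measurable_euclidean_space[THEN iffD2], intro ballI)
  fix b :: "real^'n" assume "b \<in> Basis"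
  then obtain i where b: "b = axis i 1" by (auto simp: Basis_vec_def)
  have "(\<lambda>x. x i) \<in> PiM UNIV M \<rightarrow>\<^sub>M M i" by measurable
  then have "(\<lambda>x. x i) \<in> borel_measurable (PiM UNIV M)"
    using assms by (simp cong: measurable_cong_sets)
  then show "(\<lambda>x. (\<chi> i. x i) \<bullet> b) \<in> borel_measurable (PiM UNIV M)"
    by (simp add: b inner_axis)
qed

text \<open>Lebesgue measure is determined by its values on boxes, and the preimage of a box is a
  product of intervals. This carries product measures on functions over to vectors.\<close>

lemma lborel_vec_eq_distr_PiM:
  "distr (PiM UNIV (\<lambda>_. lborel)) borel (\<lambda>x. \<chi> i. x i) = (lborel :: (real^'n) measure)"
proof (rule lborel_eqI[symmetric])
  interpret product_sigma_finite "\<lambda>_::'n. lborel :: real measure" by standard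
  have m: "(\<lambda>x. \<chi> i. x i) \<in> PiM UNIV (\<lambda>_. lborel) \<rightarrow>\<^sub>M (borel :: (real^'n) measure)"
    by (rule vec_lambda_measurable) simp
  fix l u :: "real^'n" assume lu: "\<And>b. b \<in> Basis \<Longrightarrow> l \<bullet> b \<le> u \<bullet> b"
  have le: "l $ i \<le> u $ i" for i
    using lu[of "axis i 1"] axis_in_Basis_iff[of i "1::real"] by (simp add: inner_axis)
  have "(\<lambda>x. \<chi> i. x i) -` box l u \<inter> space (PiM UNIV (\<lambda>_. lborel)) = (\<Pi>\<^sub>E i\<in>UNIV. {l $ i<..<u $ i})"
    by (auto simp: space_PiM mem_box_cart PiE_UNIV_domain Pi_iff)
  then have "emeasure (distr (PiM UNIV (\<lambda>_. lborel)) borel (\<lambda>x. \<chi> i. x i)) (box l u)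
      = (\<Prod>i\<in>UNIV. ennreal (u $ i - l $ i))"
    by (subst emeasure_distr[OF m]) (simp_all add: emeasure_PiM le)
  also have "\<dots> = ennreal (\<Prod>i\<in>UNIV. (u - l) $ i)"
    by (simp add: prod_ennreal le)
  also have "(\<Prod>i\<in>UNIV. (u - l) $ i) = (\<Prod>b\<in>Basis. (u - l) \<bullet> b)"
  proof -
    have B: "(Basis :: (real^'n) set) = (\<lambda>i. axis i 1) ` UNIV" by (auto simp: Basis_vec_def)
    have "inj (\<lambda>i::'n. axis i 1 :: real^'n)" by (auto simp: inj_on_def axis_eq_axis)
    then show ?thesis unfolding B by (simp add: prod.reindex inner_axis)
  qed
  finally show "emeasure (distr (PiM UNIV (\<lambda>_. lborel)) borel (\<lambda>x. \<chi> i. x i)) (box l u)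
      = (\<Prod>b\<in>Basis. (u - l) \<bullet> b)" .
qed simp

text \<open>A product measure is determined by its values on rectangles, where the indicator
  factorises along with the density.\<close>

lemma PiM_density:
  fixes N :: "'i::finite \<Rightarrow> 'b measure" and \<rho> :: "'i \<Rightarrow> 'b \<Rightarrow> ennreal"
  assumes "\<And>i. sigma_finite_measure (N i)" "\<And>i. sigma_finite_measure (density (N i) (\<rho> i))"
    and [measurable]: "\<And>i. \<rho> i \<in> borel_measurable (N i)"
  shows "PiM UNIV (\<lambda>i. density (N i) (\<rho> i)) = density (PiM UNIV N) (\<lambda>x. \<Prod>i\<in>UNIV. \<rho> i (x i))"
proof -
  interpret N: product_sigma_finite N using assms(1) by (simp add: product_sigma_finite_def)
  interpret D: product_sigma_finite "\<lambda>i. density (N i) (\<rho> i)"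
    using assms(2) by (simp add: product_sigma_finite_def)
  show ?thesis
  proof (rule D.PiM_eqI[symmetric])
    show "sets (density (PiM UNIV N) (\<lambda>x. \<Prod>i\<in>UNIV. \<rho> i (x i))) = sets (PiM UNIV (\<lambda>i. density (N i) (\<rho> i)))"
      by (simp cong: sets_PiM_cong)
    fix A assume "\<And>i. i \<in> UNIV \<Longrightarrow> A i \<in> sets (density (N i) (\<rho> i))"
    then have A [measurable]: "A i \<in> sets (N i)" for i by simp
    have "emeasure (density (PiM UNIV N) (\<lambda>x. \<Prod>i\<in>UNIV. \<rho> i (x i))) (Pi\<^sub>E UNIV A)
        = (\<integral>\<^sup>+x. (\<Prod>i\<in>UNIV. \<rho> i (x i)) * indicator (Pi\<^sub>E UNIV A) x \<partial>PiM UNIV N)"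
      by (rule emeasure_density) measurable
    also have "\<dots> = (\<integral>\<^sup>+x. (\<Prod>i\<in>UNIV. \<rho> i (x i) * indicator (A i) (x i)) \<partial>PiM UNIV N)"
    proof (rule nn_integral_cong)
      fix x
      have "indicator (Pi\<^sub>E UNIV A) x = (\<Prod>i\<in>UNIV. indicator (A i) (x i) :: ennreal)"
      proof (cases "\<forall>i. x i \<in> A i")
        case True
        then show ?thesis by (simp add: PiE_def Pi_def)
      next
        case False
        then obtain i where i: "x i \<notin> A i" by blast
        then have "(\<Prod>i\<in>UNIV. indicator (A i) (x i) :: ennreal) = 0" by (intro prod_zero bexI[of _ i]) auto
        moreover have "x \<notin> Pi\<^sub>E UNIV A" using i by (auto simp: PiE_def Pi_def)
        ultimately show ?thesis by simp
      qed
      then show "(\<Prod>i\<in>UNIV. \<rho> i (x i)) * indicator (Pi\<^sub>E UNIV A) x = (\<Prod>i\<in>UNIV. \<rho> i (x i) * indicator (A i) (x i))"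
        by (simp add: prod.distrib)
    qed
    also have "\<dots> = (\<Prod>i\<in>UNIV. \<integral>\<^sup>+t. \<rho> i t * indicator (A i) t \<partial>N i)"
      by (rule N.product_nn_integral_prod) auto
    also have "\<dots> = (\<Prod>i\<in>UNIV. emeasure (density (N i) (\<rho> i)) (A i))"
      by (simp add: emeasure_density)
    finally show "emeasure (density (PiM UNIV N) (\<lambda>x. \<Prod>i\<in>UNIV. \<rho> i (x i))) (Pi\<^sub>E UNIV A)
        = (\<Prod>i\<in>UNIV. emeasure (density (N i) (\<rho> i)) (A i))" .
  qed simp
qed

lemma distr_PiM_factor:
  fixes \<alpha> :: "real^'n"
  assumes s: "s > 0" and a: "\<And>i. \<alpha> $ i \<ge> 0"
  shows "distr (PiM UNIV (factor \<alpha> s)) borel (\<lambda>x. \<chi> i. x i)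
    = density lborel (\<lambda>x. ennreal (\<Prod>i\<in>UNIV. factor_density \<alpha> s i (x $ i)))"
proof -
  have sf: "sigma_finite_measure (factor \<alpha> s i)" for i
    using prob_space_factor[OF s a] prob_space_imp_sigma_finite by blast
  have m: "(\<lambda>x. \<chi> i. x i) \<in> PiM UNIV (\<lambda>_. lborel) \<rightarrow>\<^sub>M (borel :: (real^'n) measure)"
    by (rule vec_lambda_measurable) simp
  have "factor \<alpha> s = (\<lambda>i. density lborel (\<lambda>t. ennreal (factor_density \<alpha> s i t)))"
    by (simp add: fun_eq_iff factor_eq_density)
  then have "PiM UNIV (factor \<alpha> s) = PiM UNIV (\<lambda>i. density lborel (\<lambda>t. ennreal (factor_density \<alpha> s i t)))"
    by simp
  also have "\<dots> = density (PiM UNIV (\<lambda>_. lborel)) (\<lambda>x. \<Prod>i\<in>UNIV. ennreal (factor_density \<alpha> s i (x i)))"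
    using sf by (intro PiM_density) (auto simp: factor_eq_density[symmetric] lborel.sigma_finite_measure_axioms)
  also have "\<dots> = density (PiM UNIV (\<lambda>_. lborel))
      (\<lambda>x. ennreal (\<Prod>i\<in>UNIV. factor_density \<alpha> s i ((\<chi> i. x i) $ i)))"
    using factor_density_nonneg[OF s a] by (simp add: prod_ennreal)
  also have "distr \<dots> borel (\<lambda>x. \<chi> i. x i)
      = density (distr (PiM UNIV (\<lambda>_. lborel)) borel (\<lambda>x. \<chi> i. x i))
          (\<lambda>x. ennreal (\<Prod>i\<in>UNIV. factor_density \<alpha> s i (x $ i)))"
    by (rule density_distr[symmetric, OF _ m]) measurable
  finally show ?thesis by (simp add: lborel_vec_eq_distr_PiM)
qed

lemma prod_factor_density:
  fixes \<alpha> :: "real^'n"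
  assumes a: "\<And>i. \<alpha> $ i \<ge> 0"
  shows "(\<Prod>i\<in>UNIV. factor_density \<alpha> (lam\<^sup>2) i (x $ i))
    = indicator (Rstar \<alpha>) x * wt \<alpha> lam x / (\<Prod>i\<in>UNIV. factor_mass \<alpha> (lam\<^sup>2) i)"
proof (cases "x \<in> Rstar \<alpha>")
  case True
  then have pos: "x $ i > 0" if "\<alpha> $ i \<noteq> 0" for i
    using that a[of i] by (auto simp: Rstar_def less_le)
  have "(norm x)\<^sup>2 = (\<Sum>i\<in>UNIV. (x $ i)\<^sup>2)"
    unfolding power2_norm_eq_inner inner_vec_def by (simp add: power2_eq_square)
  then have "exp (- ((norm x)\<^sup>2) / (2 * lam\<^sup>2)) = (\<Prod>i\<in>UNIV. exp (- (x $ i)\<^sup>2 / (2 * lam\<^sup>2)))"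
    by (simp add: exp_sum[symmetric] sum_negf sum_divide_distrib)
  then have "wt \<alpha> lam x = (\<Prod>i\<in>UNIV. (if \<alpha> $ i = 0 then 1 else x $ i powr \<alpha> $ i) * exp (- (x $ i)\<^sup>2 / (2 * lam\<^sup>2)))"
    by (simp add: wt_def monom_A_def prod.distrib)
  moreover have "factor_density \<alpha> (lam\<^sup>2) i (x $ i)
      = (if \<alpha> $ i = 0 then 1 else x $ i powr \<alpha> $ i) * exp (- (x $ i)\<^sup>2 / (2 * lam\<^sup>2)) / factor_mass \<alpha> (lam\<^sup>2) i" for i
    using pos[of i] by (simp add: factor_density_def factor_mass_def half_weight_def)
  ultimately show ?thesis
    using True by (simp add: prod_dividef)
next
  case False
  then obtain i where "\<alpha> $ i > 0" "\<not> x $ i > 0" by (auto simp: Rstar_def)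
  then have "factor_density \<alpha> (lam\<^sup>2) i (x $ i) = 0" by (simp add: factor_density_def)
  then have "(\<Prod>i\<in>UNIV. factor_density \<alpha> (lam\<^sup>2) i (x $ i)) = 0" by (intro prod_zero) auto
  then show ?thesis using False by simp
qed

text \<open>The constant \<open>Zconst\<close> is never computed by Fubini: the product of the
  normalised factors is proportional to the weight and has total mass 1, which forces the two
  normalisations to agree.\<close>

lemma muAl_eq_product:
  fixes \<alpha> :: "real^'n"
  assumes lam: "lam > 0" and a: "\<And>i. \<alpha> $ i \<ge> 0"
  shows "muAl \<alpha> lam = distr (PiM UNIV (factor \<alpha> (lam\<^sup>2))) borel (\<lambda>x. \<chi> i. x i)"
    and "prob_space (muAl \<alpha> lam)"
proof -
  let ?P = "PiM UNIV (factor \<alpha> (lam\<^sup>2))"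
  define Z where "Z = (\<Prod>i\<in>UNIV. factor_mass \<alpha> (lam\<^sup>2) i)"
  let ?v = "\<lambda>x. (\<chi> i. x i) :: real^'n"
  have s: "lam\<^sup>2 > 0" using lam by simp
  have Z: "Z > 0" unfolding Z_def by (intro prod_pos factor_mass_pos s a ballI)
  have P: "prob_space (distr ?P borel ?v)"
    by (intro prob_space.prob_space_distr prob_space_PiM prob_space_factor s a vec_lambda_measurable) simp
  define F where "F x = indicator (Rstar \<alpha>) x * wt \<alpha> lam x / Z" for x
  have F: "F x = (\<Prod>i\<in>UNIV. factor_density \<alpha> (lam\<^sup>2) i (x $ i))" for x
    unfolding F_def Z_def by (rule prod_factor_density[OF a, symmetric])
  have Fm [measurable]: "F \<in> borel_measurable borel"
    unfolding F[abs_def] by measurable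
  have F0: "F x \<ge> 0" for x unfolding F by (intro prod_nonneg ballI factor_density_nonneg s a)
  have D: "distr ?P borel ?v = density lborel (\<lambda>x. ennreal (F x))"
    unfolding F by (rule distr_PiM_factor[OF s a])
  have "(\<integral>\<^sup>+x. ennreal (F x) \<partial>lborel) = emeasure (distr ?P borel ?v) UNIV"
    unfolding D by (subst emeasure_density) auto
  also have "\<dots> = 1" using prob_space.emeasure_space_1[OF P] by simp
  finally have "(\<integral>x. F x \<partial>lborel) = 1"
    by (simp add: integral_eq_nn_integral F0)
  moreover have "Zconst \<alpha> lam = (\<integral>x. Z * F x \<partial>lborel)"
    unfolding Zconst_def F_def using Z by simp
  ultimately have "Zconst \<alpha> lam = Z" by simp
  then show "muAl \<alpha> lam = distr ?P borel ?v" unfolding D muAl_def F_def by simp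
  then show "prob_space (muAl \<alpha> lam)" using P by simp
qed

text \<open>Split coordinate k off the product. Its old value r is overwritten, so integrating over
  r only contributes the mass 1, and the fresh draw takes its place.\<close>

lemma distr_PiM_resample:
  fixes N :: "'n::finite \<Rightarrow> real measure"
  assumes N: "\<And>i. prob_space (N i)" and sets: "\<And>i. sets (N i) = sets borel"
  defines "M \<equiv> distr (PiM UNIV N) borel (\<lambda>x. \<chi> i. x i)"
  shows "distr (M \<Otimes>\<^sub>M N k) borel (\<lambda>(x, t). upd x k t) = M"
proof (rule measure_eqI)
  interpret N: product_sigma_finite N
    using N prob_space_imp_sigma_finite by (auto simp: product_sigma_finite_def)
  interpret Nk: prob_space "N k" by (rule N)
  let ?v = "\<lambda>x. (\<chi> i. x i) :: real^'n"
  have v [measurable]: "?v \<in> PiM UNIV N \<rightarrow>\<^sub>M borel" by (rule vec_lambda_measurable[OF sets])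
  have sM [measurable_cong]: "sets M = sets borel" by (simp add: M_def)
  note sets [measurable_cong]
  fix A assume "A \<in> sets (distr (M \<Otimes>\<^sub>M N k) borel (\<lambda>(x, t). upd x k t))"
  then have A [measurable]: "A \<in> sets borel" by simp
  let ?I = "UNIV - {k}"
  have I: "insert k ?I = UNIV" by auto
  have v_upd: "?v (x(k := t)) = upd (?v x) k t" for x t by (simp add: vec_eq_iff)
  have u: "(\<lambda>(x, t). upd x k t) \<in> M \<Otimes>\<^sub>M N k \<rightarrow>\<^sub>M borel" by measurable
  have ins: "(\<integral>\<^sup>+x. F x \<partial>PiM UNIV N) = (\<integral>\<^sup>+x. \<integral>\<^sup>+t. F (x(k := t)) \<partial>N k \<partial>PiM ?I N)"
    if "F \<in> borel_measurable (PiM UNIV N)" for F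
    using N.product_nn_integral_insert[of ?I k F] that unfolding I by simp
  have "emeasure (distr (M \<Otimes>\<^sub>M N k) borel (\<lambda>(x, t). upd x k t)) A
      = (\<integral>\<^sup>+z. indicator A z \<partial>distr (M \<Otimes>\<^sub>M N k) borel (\<lambda>(x, t). upd x k t))"
    by simp
  also have "\<dots> = (\<integral>\<^sup>+z. indicator A (case z of (x, t) \<Rightarrow> upd x k t) \<partial>(M \<Otimes>\<^sub>M N k))"
    by (rule nn_integral_distr[OF u]) simp
  also have "\<dots> = (\<integral>\<^sup>+x. \<integral>\<^sup>+t. indicator A (upd x k t) \<partial>N k \<partial>M)"
    by (subst sigma_finite_measure.nn_integral_fst[OF prob_space_imp_sigma_finite[OF N], symmetric]) simp_all
  also have "\<dots> = (\<integral>\<^sup>+x. \<integral>\<^sup>+t. indicator A (upd (?v x) k t) \<partial>N k \<partial>PiM UNIV N)"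
    unfolding M_def by (rule nn_integral_distr[OF v]) measurable
  also have "\<dots> = (\<integral>\<^sup>+x. \<integral>\<^sup>+r. \<integral>\<^sup>+t. indicator A (upd (?v (x(k := r))) k t) \<partial>N k \<partial>N k \<partial>PiM ?I N)"
    by (rule ins) measurable
  also have "\<dots> = (\<integral>\<^sup>+x. \<integral>\<^sup>+t. indicator A (?v (x(k := t))) \<partial>N k \<partial>PiM ?I N)"
    by (simp only: v_upd upd_upd nn_integral_const Nk.emeasure_space_1 mult_1_right)
  also have "\<dots> = (\<integral>\<^sup>+x. indicator A (?v x) \<partial>PiM UNIV N)"
    by (rule ins[symmetric]) measurable
  also have "\<dots> = (\<integral>\<^sup>+x. indicator A x \<partial>M)"
    unfolding M_def by (rule nn_integral_distr[OF v, symmetric]) simp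
  also have "\<dots> = emeasure M A" using sM by simp
  finally show "emeasure (distr (M \<Otimes>\<^sub>M N k) borel (\<lambda>(x, t). upd x k t)) A = emeasure M A" .
qed (simp add: M_def)

lemma resampling_muAl:
  fixes \<alpha> :: "real^'n"
  assumes lam: "lam > 0" and a: "\<And>i. \<alpha> $ i \<ge> 0"
  shows "resampling (muAl \<alpha> lam) (factor \<alpha> (lam\<^sup>2)) {i. \<alpha> $ i = 0} (lam\<^sup>2)"
proof (rule resampling.intro)
  have s: "lam\<^sup>2 > 0" using lam by simp
  note P = prob_space_factor[OF s a]
  show "prob_space (muAl \<alpha> lam)" by (rule muAl_eq_product[OF lam a])
  show "sets (muAl \<alpha> lam) = sets borel" by (simp add: muAl_def)
  fix k
  show "prob_space (factor \<alpha> (lam\<^sup>2) k)" by (rule P)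
  show "sets (factor \<alpha> (lam\<^sup>2) k) = sets borel" by simp
  show "distr (muAl \<alpha> lam \<Otimes>\<^sub>M factor \<alpha> (lam\<^sup>2) k) borel (\<lambda>(x, t). upd x k t) = muAl \<alpha> lam"
    unfolding muAl_eq_product(1)[OF lam a] by (rule distr_PiM_resample[OF P]) simp
  show "0 < lam\<^sup>2" by (rule s)
  show "integrable (factor \<alpha> (lam\<^sup>2) k) (\<lambda>t. t\<^sup>2)"
    using gauss_square_integrable[OF s] half_measure_square_integrable[OF s a] by (simp add: factor_def)
  show "(\<integral>t. t \<partial>factor \<alpha> (lam\<^sup>2) k) = 0" "(\<integral>t. t\<^sup>2 \<partial>factor \<alpha> (lam\<^sup>2) k) = lam\<^sup>2"
    if "k \<in> {i. \<alpha> $ i = 0}"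
    using that gauss_mean[OF s] gauss_variance[OF s] by (simp_all add: factor_def)
  fix h h' assume h: "C1b_real h h'"
  show "(\<integral>t. t * h t \<partial>factor \<alpha> (lam\<^sup>2) k) = lam\<^sup>2 * (\<integral>t. h' t \<partial>factor \<alpha> (lam\<^sup>2) k)"
    if "k \<in> {i. \<alpha> $ i = 0}"
    using that gauss_parts[OF s h] by (simp add: factor_def)
  show "2 * ((\<integral>t. (h t)\<^sup>2 \<partial>factor \<alpha> (lam\<^sup>2) k) - (\<integral>t. h t \<partial>factor \<alpha> (lam\<^sup>2) k)\<^sup>2)
      \<le> lam\<^sup>2 * ((\<integral>t. (h' t)\<^sup>2 \<partial>factor \<alpha> (lam\<^sup>2) k)
        + (if k \<in> {i. \<alpha> $ i = 0} then (\<integral>t. h' t \<partial>factor \<alpha> (lam\<^sup>2) k)\<^sup>2 else 0))"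
  proof (cases "\<alpha> $ k = 0")
    case True
    then show ?thesis using gauss_poincare[OF s h] by (simp add: factor_def)
  next
    case False
    then show ?thesis using half_measure_poincare_C1b[OF s a h, of k] by (simp add: factor_def)
  qed
qed

section \<open>Test functions and the completion\<close>

lemma Cinf_has_partials:
  assumes "f \<in> Cinf"
  shows "f differentiable (at x)" "continuous_on UNIV f" "continuous_on UNIV (pd i f)"
proof -
  have "f \<in> Ck (Suc 0)" "f \<in> Ck 0" using assms unfolding Cinf_def by blast+
  then show "f differentiable (at x)" "continuous_on UNIV f" "continuous_on UNIV (pd i f)" by auto
qed

lemma bcont_compact_support:
  assumes "continuous_on UNIV f" "compact S" "\<And>x. x \<notin> S \<Longrightarrow> f x = 0"
  shows "bcont f"
proof -
  have "bounded (f ` S)"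
    using assms(1,2) by (intro compact_imp_bounded compact_continuous_image) (auto intro: continuous_on_subset)
  then have "bounded (insert 0 (f ` S))" by simp
  moreover have "range f \<subseteq> insert 0 (f ` S)" using assms(3) by auto
  ultimately show ?thesis unfolding bcont_def using assms(1) bounded_subset by blast
qed

text \<open>Compact support turns continuity into boundedness; the partial derivatives share the
  support because f vanishes near every point outside the closed set \<open>?S\<close>.\<close>

lemma C1b_Nstar:
  assumes "f \<in> Nstar \<alpha>"
  shows "C1b f (\<lambda>i. pd i f)"
proof -
  let ?S = "closure {x. f x \<noteq> 0}"
  have f: "f \<in> Cinf" and S: "compact ?S" using assms by (auto simp: Nstar_def)
  have f0: "f x = 0" if "x \<notin> ?S" for x
    using that closure_subset[of "{x. f x \<noteq> 0}"] by blast
  have pd0: "pd i f x = 0" if "x \<notin> ?S" for i x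
  proof -
    have "((\<lambda>x. 0) has_derivative (\<lambda>h. 0)) (at x)" by simp
    moreover have "open (- ?S)" by (rule open_Compl[OF closed_closure])
    moreover have "x \<in> - ?S" using that by (simp only: Compl_iff not_False_eq_True)
    moreover have "0 = f y" if "y \<in> - ?S" for y
      by (rule f0[symmetric]) (use that in \<open>simp only: Compl_iff not_False_eq_True\<close>)
    ultimately have "(f has_derivative (\<lambda>h. 0)) (at x)"
      by (rule has_derivative_transform_within_open)
    from frechet_derivative_at[OF this] show ?thesis unfolding pd_def by metis
  qed
  have der: "((\<lambda>t. f (upd x i t)) has_real_derivative pd i f x) (at (x $ i))" for i x
  proof -
    let ?D = "frechet_derivative f (at x)"
    have D: "(f has_derivative ?D) (at x)"
      using Cinf_has_partials(1)[OF f] frechet_derivative_works by blast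
    have lin: "linear ?D" using D by (rule has_derivative_linear)
    have "((\<lambda>t. x + (t - x $ i) *\<^sub>R axis i 1) has_derivative (\<lambda>h. h *\<^sub>R axis i 1)) (at (x $ i))"
      by (auto intro!: derivative_eq_intros)
    then have U: "((\<lambda>t. upd x i t) has_derivative (\<lambda>h. h *\<^sub>R axis i 1)) (at (x $ i))"
      by (simp add: upd_eq_axis)
    have "((\<lambda>t. f (upd x i t)) has_derivative (\<lambda>h. ?D (h *\<^sub>R axis i 1))) (at (x $ i))"
      by (rule has_derivative_compose[OF U]) (simp add: D)
    then show ?thesis
      by (simp add: has_field_derivative_def pd_def linear_cmul[OF lin] mult_commute_abs)
  qed
  show ?thesis
    unfolding C1b_def
    by (intro conjI allI der bcont_compact_support[OF _ S] Cinf_has_partials[OF f] f0 pd0)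
qed

lemma norm_grad_square: "(norm (grad f x))\<^sup>2 = (\<Sum>i\<in>UNIV. (pd i f x)\<^sup>2)"
  unfolding power2_norm_eq_inner inner_vec_def grad_def by (simp add: power2_eq_square)

lemma mean_eq_0:
  fixes \<alpha> :: "real^'n"
  assumes a: "\<And>i. \<alpha> $ i \<ge> 0" and i: "\<alpha> $ i = 0"
  shows "(\<integral>x. x \<partial>muAl \<alpha> 1) $ i = 0"
\<comment> \<open>If the identity were not integrable, its Bochner integral would be 0 by
  convention, and the claim would hold as well.\<close>
proof (cases "integrable (muAl \<alpha> 1) (\<lambda>x. x)")
  case True
  interpret resampling "muAl \<alpha> 1" "factor \<alpha> (1\<^sup>2)" "{i. \<alpha> $ i = 0}" "1\<^sup>2"
    by (rule resampling_muAl) (simp_all add: a)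
  have "(\<integral>x. x \<partial>muAl \<alpha> 1) $ i = (\<integral>x. x $ i \<partial>muAl \<alpha> 1)"
    by (rule integral_bounded_linear[OF bounded_linear_vec_nth True, symmetric])
  then show ?thesis using integral_coordinate[of i] i by simp
qed (simp add: not_integrable_integral_eq)

section \<open>Passage to the completion\<close>

text \<open>Young's inequality with e kept free, so that the factor of a^2 can later tend to
  1.\<close>

lemma square_add_le:
  fixes a b e :: real
  assumes "e > 0"
  shows "(a + b)\<^sup>2 \<le> (1 + e) * a\<^sup>2 + (1 + 1 / e) * b\<^sup>2"
proof -
  have "0 \<le> (e * a - b)\<^sup>2 / e" using assms by simp
  also have "\<dots> = (1 + e) * a\<^sup>2 + (1 + 1 / e) * b\<^sup>2 - (a + b)\<^sup>2"
    using assms by (simp add: field_simps power2_eq_square)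
  finally show ?thesis by simp
qed

lemma norm_square_add_le:
  fixes a b :: "'a::real_normed_vector"
  assumes "e > 0"
  shows "(norm (a + b))\<^sup>2 \<le> (1 + e) * (norm a)\<^sup>2 + (1 + 1 / e) * (norm b)\<^sup>2"
proof -
  have "(norm (a + b))\<^sup>2 \<le> (norm a + norm b)\<^sup>2"
    by (intro power_mono norm_triangle_ineq) simp
  also have "\<dots> \<le> (1 + e) * (norm a)\<^sup>2 + (1 + 1 / e) * (norm b)\<^sup>2"
    by (rule square_add_le[OF assms])
  finally show ?thesis .
qed

lemma nn_integral_linear_bound:
  assumes "\<And>x. f x \<le> p * g x + q * h x" "p \<ge> 0" "q \<ge> 0" "\<And>x. g x \<ge> 0" "\<And>x. h x \<ge> 0"
    and [measurable]: "g \<in> borel_measurable M" "h \<in> borel_measurable M"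
  shows "(\<integral>\<^sup>+x. ennreal (f x) \<partial>M)
    \<le> ennreal p * (\<integral>\<^sup>+x. ennreal (g x) \<partial>M) + ennreal q * (\<integral>\<^sup>+x. ennreal (h x) \<partial>M)"
proof -
  have "(\<integral>\<^sup>+x. ennreal (f x) \<partial>M) \<le> (\<integral>\<^sup>+x. ennreal p * ennreal (g x) + ennreal q * ennreal (h x) \<partial>M)"
  proof (rule nn_integral_mono)
    fix x
    have "ennreal (f x) \<le> ennreal (p * g x + q * h x)" by (rule ennreal_leI[OF assms(1)])
    also have "\<dots> = ennreal p * ennreal (g x) + ennreal q * ennreal (h x)"
      using assms(2-5) by (simp add: ennreal_mult)
    finally show "ennreal (f x) \<le> ennreal p * ennreal (g x) + ennreal q * ennreal (h x)" .
  qed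
  also have "\<dots> = ennreal p * (\<integral>\<^sup>+x. ennreal (g x) \<partial>M) + ennreal q * (\<integral>\<^sup>+x. ennreal (h x) \<partial>M)"
    by (simp add: nn_integral_add nn_integral_cmult)
  finally show ?thesis .
qed

theorem theorem1p8:
  fixes \<alpha> :: "real^'n" and lam :: real
    and u :: "real^'n \<Rightarrow> real" and g :: "real^'n \<Rightarrow> real^'n"
  assumes "\<forall>i. \<alpha>$i \<ge> 0"
    and "lam > 0"
    and "(u, g) \<in> Xspace lam \<alpha>"
  defines "m \<equiv> integral\<^sup>L (muAl \<alpha> 1) (\<lambda>x. x)"
  shows "(\<integral>\<^sup>+ x. ennreal ((norm (g x))^2) \<partial>muAl \<alpha> lam) \<ge>
    ennreal (1 / lam^2) *
      (INF c\<in>(UNIV::real set). INF d\<in>(UNIV::(real^'n) set).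
        \<integral>\<^sup>+ x. ennreal ((u x - c)^2 +
           (1/2) * (u x - c + inner d m - c * (norm m)^2 - inner d x + c * inner m x)^2)
        \<partial>muAl \<alpha> lam)"
proof -
  let ?M = "muAl \<alpha> lam"
  let ?Q = "\<lambda>u c d x. (u x - c)\<^sup>2 + 1 / 2 * (u x - c - d \<bullet> x)\<^sup>2 :: real"
  have a: "\<alpha> $ i \<ge> 0" for i using assms(1) by blast
  interpret resampling ?M "factor \<alpha> (lam\<^sup>2)" "{i. \<alpha> $ i = 0}" "lam\<^sup>2"
    by (rule resampling_muAl[OF assms(2) a])
  define I where "I = (INF c\<in>(UNIV::real set). INF d\<in>(UNIV::(real^'n) set).
        \<integral>\<^sup>+ x. ennreal ((u x - c)^2 +
           (1/2) * (u x - c + inner d m - c * (norm m)^2 - inner d x + c * inner m x)^2) \<partial>?M)"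
  define A where "A = (\<integral>\<^sup>+x. ennreal ((norm (g x))\<^sup>2) \<partial>?M)"
  obtain \<phi> where um: "u \<in> borel_measurable ?M" and gm: "g \<in> borel_measurable ?M"
    and \<phi>: "\<And>n. \<phi> n \<in> Nstar \<alpha>"
    and lim_u: "(\<lambda>n. \<integral>\<^sup>+x. ennreal ((\<phi> n x - u x)\<^sup>2) \<partial>?M) \<longlonglongrightarrow> 0"
    and lim_g: "(\<lambda>n. \<integral>\<^sup>+x. ennreal ((norm (grad (\<phi> n) x - g x))\<^sup>2) \<partial>?M) \<longlonglongrightarrow> 0"
    using assms(3) unfolding Xspace_def by blast
  define \<delta> where "\<delta> n = (\<integral>\<^sup>+x. ennreal ((\<phi> n x - u x)\<^sup>2) \<partial>?M)" for n
  define \<eta> where "\<eta> n = (\<integral>\<^sup>+x. ennreal ((norm (grad (\<phi> n) x - g x))\<^sup>2) \<partial>?M)" for n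
  \<comment> \<open>The infimum is tested at c and c m + d: the part c m cancels both c |m|^2 and c
    m \<bullet> x, and d \<bullet> m = 0 coordinate by coordinate.\<close>
  have I_le: "I \<le> (\<integral>\<^sup>+x. ennreal (?Q u c d x) \<partial>?M)" if "\<And>i. \<alpha> $ i \<noteq> 0 \<Longrightarrow> d $ i = 0" for c d
  proof -
    have "d \<bullet> m = (\<Sum>i\<in>UNIV. d $ i * m $ i)" by (simp add: inner_vec_def)
    also have "\<dots> = 0"
    proof (rule sum.neutral, rule ballI)
      fix i
      show "d $ i * m $ i = 0" using that[of i] mean_eq_0[OF a, of i] unfolding m_def by auto
    qed
    finally have "u x - c + (c *\<^sub>R m + d) \<bullet> m - c * (norm m)\<^sup>2 - (c *\<^sub>R m + d) \<bullet> x + c * (m \<bullet> x)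
        = u x - c - d \<bullet> x" for x
      by (simp add: inner_add_left power2_norm_eq_inner)
    then have "(\<integral>\<^sup>+x. ennreal (?Q u c d x) \<partial>?M) = (\<integral>\<^sup>+ x. ennreal ((u x - c)^2 +
           (1/2) * (u x - c + inner (c *\<^sub>R m + d) m - c * (norm m)^2 - inner (c *\<^sub>R m + d) x + c * inner m x)^2) \<partial>?M)"
      by (simp only:)
    then show ?thesis unfolding I_def by (auto intro!: INF_lower2[of c] INF_lower2[of "c *\<^sub>R m + d"])
  qed
  \<comment> \<open>The pair (c, d) belongs to \<open>\<phi> n\<close> and is not controlled as n
    grows, so the error is absorbed by Young's inequality, whose constants do not depend on it. The
    factor 3/2 = 1 + 1/2 arises because the difference of \<open>\<phi> n\<close> and u enters both
    squares.\<close>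
  have step: "I \<le> ennreal (1 + e) * (ennreal (lam\<^sup>2) * (ennreal (1 + e) * A + ennreal (1 + 1 / e) * \<eta> n))
      + ennreal (3 / 2 * (1 + 1 / e)) * \<delta> n" if e: "e > 0" for e n
  proof -
    let ?f = "\<phi> n"
    have f: "C1b ?f (\<lambda>i. pd i ?f)" by (rule C1b_Nstar[OF \<phi>])
    have fc: "continuous_on UNIV ?f" and pc: "\<And>i. continuous_on UNIV (pd i ?f)"
      using f unfolding C1b_def bcont_def by auto
    have [measurable]: "?f \<in> borel_measurable ?M"
      using borel_measurable_continuous_onI[OF fc] sets_M by (simp cong: measurable_cong_sets)
    have "continuous_on UNIV (grad ?f)"
      unfolding grad_def[abs_def] by (intro continuous_on_vec_lambda pc)
    then have [measurable]: "grad ?f \<in> borel_measurable ?M"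
      using borel_measurable_continuous_onI[of "grad ?f"] sets_M by (simp cong: measurable_cong_sets)
    note um [measurable] and gm [measurable]
    obtain c d where d: "\<And>i. i \<notin> {i. \<alpha> $ i = 0} \<Longrightarrow> d $ i = 0"
      and Q: "(\<integral>\<^sup>+x. ennreal (?Q ?f c d x) \<partial>?M) \<le> ennreal (lam\<^sup>2) * (\<integral>\<^sup>+x. ennreal (\<Sum>i\<in>UNIV. (pd i ?f x)\<^sup>2) \<partial>?M)"
      by (rule affine_approximation[OF f]) (rule that, assumption+)
    have [measurable]: "(\<lambda>x. d \<bullet> x) \<in> borel_measurable ?M"
    proof -
      have "continuous_on UNIV (\<lambda>x. d \<bullet> x)" by (intro continuous_intros)
      then show ?thesis
        using borel_measurable_continuous_onI[of "\<lambda>x. d \<bullet> x"] sets_M by (simp cong: measurable_cong_sets)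
    qed
    have "I \<le> (\<integral>\<^sup>+x. ennreal (?Q u c d x) \<partial>?M)"
      by (rule I_le) (use d in auto)
    also have "\<dots> \<le> ennreal (1 + e) * (\<integral>\<^sup>+x. ennreal (?Q ?f c d x) \<partial>?M)
        + ennreal (3 / 2 * (1 + 1 / e)) * \<delta> n"
      unfolding \<delta>_def
    proof (rule nn_integral_linear_bound)
      fix x
      have 1: "(u x - c)\<^sup>2 \<le> (1 + e) * (?f x - c)\<^sup>2 + (1 + 1 / e) * (?f x - u x)\<^sup>2"
        using square_add_le[OF e, of "?f x - c" "u x - ?f x"] by (simp add: power2_commute[of "u x" "?f x"])
      have 2: "(u x - c - d \<bullet> x)\<^sup>2 \<le> (1 + e) * (?f x - c - d \<bullet> x)\<^sup>2 + (1 + 1 / e) * (?f x - u x)\<^sup>2"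
        using square_add_le[OF e, of "?f x - c - d \<bullet> x" "u x - ?f x"]
        unfolding power2_commute[of "u x" "?f x"] by (simp add: add_diff_eq diff_diff_eq add.commute)
      have "?Q u c d x \<le> ((1 + e) * (?f x - c)\<^sup>2 + (1 + 1 / e) * (?f x - u x)\<^sup>2)
          + 1 / 2 * ((1 + e) * (?f x - c - d \<bullet> x)\<^sup>2 + (1 + 1 / e) * (?f x - u x)\<^sup>2)"
        by (intro add_mono mult_left_mono 1 2) simp
      also have "\<dots> = (1 + e) * ?Q ?f c d x + 3 / 2 * (1 + 1 / e) * (?f x - u x)\<^sup>2"
      proof -
        have "(p * X + q * Y) + 1 / 2 * (p * Z + q * Y) = p * (X + 1 / 2 * Z) + 3 / 2 * q * Y" for p q X Y Z :: real
          by (simp add: algebra_simps)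
        then show ?thesis .
      qed
      finally show "?Q u c d x \<le> (1 + e) * ?Q ?f c d x + 3 / 2 * (1 + 1 / e) * (?f x - u x)\<^sup>2" .
    qed (use e in auto)
    also have "(\<integral>\<^sup>+x. ennreal (?Q ?f c d x) \<partial>?M)
        \<le> ennreal (lam\<^sup>2) * (\<integral>\<^sup>+x. ennreal ((norm (grad ?f x))\<^sup>2) \<partial>?M)"
      using Q by (simp only: norm_grad_square)
    also have "(\<integral>\<^sup>+x. ennreal ((norm (grad ?f x))\<^sup>2) \<partial>?M) \<le> ennreal (1 + e) * A + ennreal (1 + 1 / e) * \<eta> n"
      unfolding A_def \<eta>_def
    proof (rule nn_integral_linear_bound)
      show "(norm (grad ?f x))\<^sup>2 \<le> (1 + e) * (norm (g x))\<^sup>2 + (1 + 1 / e) * (norm (grad ?f x - g x))\<^sup>2" for x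
        using norm_square_add_le[OF e, of "g x" "grad ?f x - g x"] by simp
    qed (use e in auto)
    finally show ?thesis by (simp add: mult_left_mono add_right_mono)
  qed
  \<comment> \<open>First n tends to infinity at fixed e, which removes the terms with 1/e; only
    afterwards does e tend to 0.\<close>
  have le: "I \<le> ennreal (1 + e) * (ennreal (lam\<^sup>2) * (ennreal (1 + e) * A))" if e: "e > 0" for e
  proof (rule LIMSEQ_le_const)
    have "(\<lambda>n. ennreal (1 + e) * (ennreal (lam\<^sup>2) * (ennreal (1 + e) * A + ennreal (1 + 1 / e) * \<eta> n))
        + ennreal (3 / 2 * (1 + 1 / e)) * \<delta> n)
      \<longlonglongrightarrow> ennreal (1 + e) * (ennreal (lam\<^sup>2) * (ennreal (1 + e) * A + ennreal (1 + 1 / e) * 0))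
        + ennreal (3 / 2 * (1 + 1 / e)) * 0"
      unfolding \<delta>_def \<eta>_def
      by (intro tendsto_add ennreal_tendsto_cmult lim_u lim_g tendsto_const) (simp_all add: ennreal_less_top)
    then show "(\<lambda>n. ennreal (1 + e) * (ennreal (lam\<^sup>2) * (ennreal (1 + e) * A + ennreal (1 + 1 / e) * \<eta> n))
        + ennreal (3 / 2 * (1 + 1 / e)) * \<delta> n) \<longlonglongrightarrow> ennreal (1 + e) * (ennreal (lam\<^sup>2) * (ennreal (1 + e) * A))"
      by simp
  qed (use step[OF e] in blast)
  have "I \<le> ennreal (lam\<^sup>2) * A"
  \<comment> \<open>The limit e -> 0 is taken under multiplication by the constant A, which is done
    for finite A; for infinite A the bound is trivial since lam^2 > 0.\<close>
  proof (cases "A = top")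
    case True
    then show ?thesis using assms(2) by (simp add: ennreal_mult_top)
  next
    case False
    have lim: "(\<lambda>n. A * ennreal ((1 + 1 / real (Suc n)) * (lam\<^sup>2 * (1 + 1 / real (Suc n))))) \<longlonglongrightarrow>
        A * ennreal ((1 + 0) * (lam\<^sup>2 * (1 + 0)))"
      using False by (intro ennreal_tendsto_cmult tendsto_ennrealI tendsto_intros LIMSEQ_Suc lim_1_over_n)
        (simp add: less_top)
    have bound: "I \<le> A * ennreal ((1 + 1 / real (Suc n)) * (lam\<^sup>2 * (1 + 1 / real (Suc n))))" for n
    proof -
      have "I \<le> ennreal (1 + 1 / real (Suc n)) * (ennreal (lam\<^sup>2) * (ennreal (1 + 1 / real (Suc n)) * A))"
        by (rule le) simp
      also have "\<dots> = A * (ennreal (1 + 1 / real (Suc n)) * (ennreal (lam\<^sup>2) * ennreal (1 + 1 / real (Suc n))))"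
        by (simp only: mult_ac)
      also have "\<dots> = A * ennreal ((1 + 1 / real (Suc n)) * (lam\<^sup>2 * (1 + 1 / real (Suc n))))"
        by (subst ennreal_mult[symmetric], simp, simp)+ simp
      finally show ?thesis .
    qed
    have "I \<le> A * ennreal ((1 + 0) * (lam\<^sup>2 * (1 + 0)))"
      by (rule LIMSEQ_le_const[OF lim]) (use bound in blast)
    then show ?thesis by (simp add: mult.commute)
  qed
  then have "ennreal (1 / lam\<^sup>2) * I \<le> ennreal (1 / lam\<^sup>2) * (ennreal (lam\<^sup>2) * A)"
    by (rule mult_left_mono) simp
  also have "\<dots> = A"
    using assms(2) by (simp add: mult.assoc[symmetric] ennreal_mult[symmetric])
  finally show ?thesis unfolding A_def I_def .
qed

end
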